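(* Assume $z_1=\tilde z$. Posterior samples of $\Theta$ take the form $\overline\theta+\hat\theta+\breve\theta$; that is, the random vector $\overline\theta+\hat\theta+\breve\theta$ has the posterior distribution $\mathcal N(\overline\theta,\Sigma)$, where $\overline\theta$ is given by $$\overline{\theta}=\frac{1}{\alpha_d}\sum_{\ell=1}^N\left[\begin{pmatrix} a_\ell\, u_\ell\\ u_\ell\otimes M_z^{-1}W_z^{-1}(z_\ell-\tilde z)\end{pmatrix}-\sum_{i=1}^N b_{i,\ell}\begin{pmatrix} s_i\, u_{i,\ell}\\ u_{i,\ell}\otimes M_z^{-1}W_z^{-1}y_i\end{pmatrix}\right],$$ and $$\hat\theta=\sqrt{\alpha_d}\sum_{i=1}^N\frac{1}{\sqrt{\mu_i}}\begin{pmatrix} s_i\,\hat u_i\\ \hat u_i\otimes M_z^{-1}W_z^{-1}y_i\end{pmatrix},\qquad \breve\theta=\sum_{k=1}^{n-N+1}\begin{pmatrix}\breve s_k\,\breve u_k\\ \breve u_k\otimes\breve y_k\end{pmatrix},$$ with mutually independent random vectors $$\hat u_i\sim\mathcal N\left(0,(\alpha_dW_u+\mu_iM_u)^{-1}\right),\ i=1,\dots,N,\qquad \breve u_k\sim\mathcal N(0,W_u^{-1}),\ k=1,\dots,n-N+1,$$ and $$\breve s_k=-\tilde z^TW_z^{-1/2}\breve z_k,\qquad \breve y_k=M_z^{-1}W_z^{-1/2}\breve z_k .$$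
   Context: Let $m,n,N$ be positive integers and $p=m(n+1)$. Let $M_u\in\mathbb{R}^{m\times m}$ and $M_z\in\mathbb{R}^{n\times n}$ be symmetric positive definite (mass) matrices, $W_u\in\mathbb{R}^{m\times m}$ and $W_z\in\mathbb{R}^{n\times n}$ symmetric positive definite (precision) matrices, $\alpha_d>0$, and $\tilde z\in\mathbb{R}^n$. $W_z^{-1/2}$ is the symmetric positive definite square root of $W_z^{-1}$. Let $z_1,\dots,z_N\in\mathbb{R}^n$ be linearly independent (inputs) and $d_1,\dots,d_N\in\mathbb{R}^m$ (data); let $d\in\mathbb{R}^{mN}$ be the vector obtained by stacking $d_1,\dots,d_N$. $I_k$ is the $k\times k$ identity and $\otimes$ is the Kronecker product. $\mathcal N(0,C)$ denotes the Gaussian distribution with mean $0$ and covariance $C$. The model discrepancy is $\delta(z,\theta)=\begin{pmatrix} I_m & I_m\otimes z^TM_z\end{pmatrix}\theta\in\mathbb{R}^m$ for $z\in\mathbb{R}^n$, $\theta\in\mathbb{R}^p$. Put $A_\ell=\begin{pmatrix} I_m & I_m\otimes z_\ell^TM_z\end{pmatrix}\in\mathbb{R}^{m\times p}$ and let $A\in\mathbb{R}^{mN\times p}$ be obtained by stacking $A_1,\dots,A_N$ vertically. The prior on $\Theta\in\mathbb{R}^p$ is Gaussian with mean $0$ and covariance $W_\theta^{-1}$, where $$W_\theta=\begin{pmatrix} W_u & W_u\otimes\tilde z^TM_z\\ W_u\otimes M_z\tilde z & W_u\otimes M_z(W_z+\tilde z\tilde z^T)M_z\end{pmatrix}\in\mathbb{R}^{p\times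 p}.$$ The data model is $d_\ell=A_\ell\Theta+\varepsilon_\ell$ with independent Gaussian noise $\varepsilon_\ell\sim\mathcal N(0,\alpha_d M_u^{-1})$. The posterior of $\Theta$ is Gaussian with mean $\overline\theta=\alpha_d^{-1}\Sigma A^T(I_N\otimes M_u)d$ and covariance $\Sigma=\left(W_\theta+\alpha_d^{-1}A^T(I_N\otimes M_u)A\right)^{-1}$. Let $Z=\begin{pmatrix} z_1&\cdots&z_N\end{pmatrix}\in\mathbb{R}^{n\times N}$, let $e\in\mathbb{R}^N$ be the vector of ones, and $$G=ee^T+(Z-\tilde z e^T)^TW_z^{-1}(Z-\tilde z e^T)\in\mathbb{R}^{N\times N}.$$ Let $(g_i,\mu_i)$, $i=1,\dots,N$, be the eigenvectors and eigenvalues of $G$, with $g_1,\dots,g_N$ orthonormal in $\mathbb{R}^N$. Define $y_i=Zg_i-(e^Tg_i)\tilde z\in\mathbb{R}^n$ and $s_i=e^Tg_i-y_i^TW_z^{-1}\tilde z\in\mathbb{R}$, and $$a_\ell=1-\tilde z^TW_z^{-1}(z_\ell-\tilde z),\quad b_{i,\ell}=(z_\ell-\tilde z)^TW_z^{-1}Zg_i+(e^Tg_i)a_\ell,\quad u_\ell=W_u^{-1}M_ud_\ell,\quad u_{i,\ell}=(\alpha_dW_u+\mu_iM_u)^{-1}M_uu_\ell .$$ $\{\breve z_1,\dots,\breve z_{n-N+1}\}\subset\mathbb{R}^n$ is an orthonormal set (Euclidean inner product) of vectors that are orthogonal to $\{W_z^{-1/2}(z_\ell-\tilde z)\}_{\ell=2}^N$.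 *)

theory Defs
  imports "HOL-Probability.Probability"
begin

text \<open>
  Every dimension is the cardinality of a finite index type. Kronecker products are indexed by
  pairs and block vectors and matrices by disjoint sums, so the parameter space of dimension
  \<open>m (n + 1)\<close> is indexed by \<open>'m + 'm \<times> 'n\<close>, and a stack of \<open>N\<close> vectors of dimension \<open>m\<close> by
  \<open>'N \<times> 'm\<close>.
\<close>

subsection \<open>Matrices\<close>

definition sym_pos_def :: "real^'n^'n \<Rightarrow> bool" where
  "sym_pos_def A \<longleftrightarrow> transpose A = A \<and> (\<forall>x. x \<noteq> 0 \<longrightarrow> 0 < x \<bullet> (A *v x))"

text \<open>The matrix \<open>v w\<^sup>T\<close>. (The library's \<open>columnvector v ** rowvector w\<close> is polymorphic in the
  contracted index type.)\<close>

definition outer :: "real^'a \<Rightarrow> real^'b \<Rightarrow> real^'b^'a" where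
  "outer v w = (\<chi> i j. v $ i * w $ j)"

definition matrix_of_columns :: "('b \<Rightarrow> real^'a) \<Rightarrow> real^'b^'a" where
  "matrix_of_columns c = (\<chi> i j. c j $ i)"

definition kron :: "real^'b^'a \<Rightarrow> real^'d^'c \<Rightarrow> real^('b \<times> 'd)^('a \<times> 'c)" where
  "kron A B = (\<chi> i j. A $ fst i $ fst j * B $ snd i $ snd j)"

text \<open>Kronecker products with a row \<open>v\<^sup>T\<close>, with a column \<open>v\<close>, and of two columns; the index
  \<open>'a \<times> 1\<close> is identified with \<open>'a\<close>.\<close>

definition kron_row :: "real^'b^'a \<Rightarrow> real^'d \<Rightarrow> real^('b \<times> 'd)^'a" where
  "kron_row A v = (\<chi> i j. A $ i $ fst j * v $ snd j)"

definition kron_col :: "real^'b^'a \<Rightarrow> real^'c \<Rightarrow> real^'b^('a \<times> 'c)" where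
  "kron_col A v = (\<chi> i j. A $ fst i $ j * v $ snd i)"

definition kron_vec :: "real^'a \<Rightarrow> real^'c \<Rightarrow> real^('a \<times> 'c)" where
  "kron_vec u v = (\<chi> i. u $ fst i * v $ snd i)"

definition block_vec :: "real^'a \<Rightarrow> real^'b \<Rightarrow> real^('a + 'b)" where
  "block_vec u v = (\<chi> i. case i of Inl k \<Rightarrow> u $ k | Inr k \<Rightarrow> v $ k)"

definition block_row :: "real^'a^'r \<Rightarrow> real^'b^'r \<Rightarrow> real^('a + 'b)^'r" where
  "block_row A B = (\<chi> i. block_vec (A $ i) (B $ i))"

definition block_matrix ::
    "real^'a^'r \<Rightarrow> real^'b^'r \<Rightarrow> real^'a^'s \<Rightarrow> real^'b^'s \<Rightarrow> real^('a + 'b)^('r + 's)" where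
  "block_matrix A B C D =
     (\<chi> i. case i of Inl k \<Rightarrow> block_vec (A $ k) (B $ k) | Inr k \<Rightarrow> block_vec (C $ k) (D $ k))"

definition stack_vec :: "('N::finite \<Rightarrow> real^'m) \<Rightarrow> real^('N \<times> 'm)" where
  "stack_vec d = (\<chi> i. d (fst i) $ snd i)"

definition stack_rows :: "('N::finite \<Rightarrow> real^'p^'m) \<Rightarrow> real^'p^('N \<times> 'm)" where
  "stack_rows A = (\<chi> i. A (fst i) $ snd i)"

subsection \<open>Gaussian distributions\<close>

text \<open>Density of the nondegenerate Gaussian with mean \<open>\<mu>\<close> and symmetric positive definite
  covariance \<open>C\<close>.\<close>

definition gaussian_density :: "real^'n \<Rightarrow> real^'n^'n \<Rightarrow> real^'n \<Rightarrow> real" where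
  "gaussian_density \<mu> C x =
     exp (- ((x - \<mu>) \<bullet> (matrix_inv C *v (x - \<mu>))) / 2) / sqrt ((2 * pi) ^ CARD('n) * det C)"

subsection \<open>Model discrepancy, prior and posterior\<close>

text \<open>The model discrepancy is \<open>\<delta>(z, \<theta>) = discrepancy_matrix Mz z *v \<theta>\<close>. The row \<open>z\<^sup>T M\<^sub>z\<close> is
  \<open>z v* Mz\<close>.\<close>

definition discrepancy_matrix :: "real^'n^'n \<Rightarrow> real^'n \<Rightarrow> real^('m + 'm \<times> 'n)^'m" where
  "discrepancy_matrix Mz z = block_row (mat 1) (kron_row (mat 1) (z v* Mz))"

definition prior_precision ::
    "real^'m^'m \<Rightarrow> real^'n^'n \<Rightarrow> real^'n^'n \<Rightarrow> real^'n
      \<Rightarrow> real^('m + 'm \<times> 'n)^('m + 'm \<times> 'n)" where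
  "prior_precision Wu Wz Mz zt =
     block_matrix Wu (kron_row Wu (zt v* Mz))
       (kron_col Wu (Mz *v zt)) (kron Wu (Mz ** (Wz + outer zt zt) ** Mz))"

text \<open>Density at the data \<open>d\<close> of the model \<open>d\<^sub>\<ell> = A\<^sub>\<ell> \<theta> + \<epsilon>\<^sub>\<ell>\<close> with independent noise
  \<open>\<epsilon>\<^sub>\<ell>\<close> distributed as \<open>N(0, \<alpha> M\<^sub>u\<^sup>-\<^sup>1)\<close>.\<close>

definition likelihood ::
    "real^'m^'m \<Rightarrow> real^'n^'n \<Rightarrow> real \<Rightarrow> ('N::finite \<Rightarrow> real^'n) \<Rightarrow> ('N \<Rightarrow> real^'m)
      \<Rightarrow> real^('m + 'm \<times> 'n) \<Rightarrow> real" where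
  "likelihood Mu Mz \<alpha> z d \<theta> =
     (\<Prod>l\<in>UNIV. gaussian_density (discrepancy_matrix Mz (z l) *v \<theta>) (\<alpha> *\<^sub>R matrix_inv Mu) (d l))"

text \<open>Density of the posterior by Bayes' formula, with prior \<open>N(0, W\<^sub>\<theta>\<^sup>-\<^sup>1)\<close>.\<close>

definition posterior_density ::
    "real^'m^'m \<Rightarrow> real^'n^'n \<Rightarrow> real^'m^'m \<Rightarrow> real^'n^'n \<Rightarrow> real^'n \<Rightarrow> real
      \<Rightarrow> ('N::finite \<Rightarrow> real^'n) \<Rightarrow> ('N \<Rightarrow> real^'m) \<Rightarrow> real^('m + 'm \<times> 'n) \<Rightarrow> real" where
  "posterior_density Wu Wz Mu Mz zt \<alpha> z d \<theta> =
     (let joint = (\<lambda>t. gaussian_density 0 (matrix_inv (prior_precision Wu Wz Mz zt)) t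
                        * likelihood Mu Mz \<alpha> z d t)
      in joint \<theta> / (LINT t|lborel. joint t))"

definition posterior_cov ::
    "real^'m^'m \<Rightarrow> real^'n^'n \<Rightarrow> real^'m^'m \<Rightarrow> real^'n^'n \<Rightarrow> real^'n \<Rightarrow> real
      \<Rightarrow> ('N::finite \<Rightarrow> real^'n) \<Rightarrow> real^('m + 'm \<times> 'n)^('m + 'm \<times> 'n)" where
  "posterior_cov Wu Wz Mu Mz zt \<alpha> z =
     (let A = stack_rows (\<lambda>l. discrepancy_matrix Mz (z l))
      in matrix_inv (prior_precision Wu Wz Mz zt
           + (1 / \<alpha>) *\<^sub>R (transpose A ** kron (mat 1) Mu ** A)))"

definition posterior_mean ::
    "real^'m^'m \<Rightarrow> real^'n^'n \<Rightarrow> real^'m^'m \<Rightarrow> real^'n^'n \<Rightarrow> real^'n \<Rightarrow> real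
      \<Rightarrow> ('N::finite \<Rightarrow> real^'n) \<Rightarrow> ('N \<Rightarrow> real^'m) \<Rightarrow> real^('m + 'm \<times> 'n)" where
  "posterior_mean Wu Wz Mu Mz zt \<alpha> z d =
     (let A = stack_rows (\<lambda>l. discrepancy_matrix Mz (z l))
      in (1 / \<alpha>) *\<^sub>R
           ((posterior_cov Wu Wz Mu Mz zt \<alpha> z ** transpose A ** kron (mat 1) Mu) *v stack_vec d))"

end

theory Submission
  imports Defs
begin

text \<open>
  A parameter \<open>\<theta>\<close> is an element of the tensor product of \<open>real^'m\<close> with the coefficient space
  \<open>real \<times> real^'n\<close>, where \<open>(s, y)\<close> stands for the affine function \<open>z \<mapsto> s + z \<bullet> M\<^sub>z y\<close>. In this reading
  the prior precision is \<open>W\<^sub>u \<otimes> K\<close> and the data add \<open>\<alpha>\<^sup>-\<^sup>1 M\<^sub>u \<otimes> H\<close>, where \<open>H = \<Sum>\<^sub>l h\<^sub>l h\<^sub>l\<^sup>T\<close> and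
  \<open>h\<^sub>l = (1, M\<^sub>z z\<^sub>l)\<close> is evaluation at \<open>z\<^sub>l\<close> (\<open>prior_precision_tensor\<close>, \<open>posterior_precision_tensor\<close>).
  Only \<open>K\<close> and \<open>H\<close>, forms on a space of dimension \<open>CARD('n) + 1\<close>, have to be diagonalised
  simultaneously.

  The matrix \<open>G\<close> has the entries \<open>h\<^sub>j \<bullet> K\<^sup>-\<^sup>1 h\<^sub>l\<close>. Hence its eigenvectors \<open>g\<^sub>i\<close> give vectors
  \<open>x\<^sub>i = \<Sum>\<^sub>j g\<^sub>i\<^sub>j K\<^sup>-\<^sup>1 h\<^sub>j\<close> that are \<open>K\<close>-orthogonal with \<open>x\<^sub>i \<bullet> K x\<^sub>i = \<mu>\<^sub>i\<close> and satisfy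
  \<open>H x\<^sub>i = \<mu>\<^sub>i K x\<^sub>i\<close>; in coordinates, \<open>x\<^sub>i = (s\<^sub>i, M\<^sub>z\<^sup>-\<^sup>1 W\<^sub>z\<^sup>-\<^sup>1 y\<^sub>i)\<close>. The vectors built from the \<open>z_breve k\<close>
  are \<open>K\<close>-orthonormal and are annihilated by all \<open>h\<^sub>l\<close>: since \<open>z\<^sub>t\<close> is itself one of the inputs, this
  amounts to orthogonality to the \<open>z\<^sub>l - z\<^sub>t\<close>. There are \<open>CARD('n) + 1\<close> vectors in total,
  so they form a basis in which the posterior precision is block diagonal, with blocks
  \<open>\<mu>\<^sub>i W\<^sub>u + \<alpha>\<^sup>-\<^sup>1 \<mu>\<^sub>i\<^sup>2 M\<^sub>u\<close> and \<open>W\<^sub>u\<close>. A Gaussian vector with that precision is sampled block by block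
  (\<open>distributed_gaussian_sum\<close>), which is the form of the two random terms.

  The formula for the mean solves the normal equations. Here \<open>b\<^sub>i\<^sub>l = \<mu>\<^sub>i g\<^sub>i\<^sub>l\<close>, and the spectral
  decomposition of \<open>G\<close> makes the correction terms cancel the contribution of the data part of the
  precision (\<open>posterior_precision_mean\<close>). Finally, completing the square identifies Bayes' density with
  the Gaussian one (\<open>gaussian_prior_times_likelihood\<close>).

  The probabilistic part reduces everything to standard Gaussian vectors. For positive definite \<open>Q\<close>
  there is a matrix \<open>B\<close> with \<open>B\<^sup>T Q B = 1\<close>, and \<open>B\<close> transports the standard Gaussian to
  \<open>N(0, Q\<^sup>-\<^sup>1)\<close> by the change of variables formula.
\<close>

section \<open>Positive definite matrices and whitening\<close>

lemma matrix_inv_eqI: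
  fixes A B :: "real^'n^'n"
  assumes "A ** B = mat 1"
  shows "matrix_inv A = B"
proof -
  have BA: "B ** A = mat 1"
    using assms by (simp add: matrix_left_right_inverse)
  have ex: "\<exists>A'. A ** A' = mat 1 \<and> A' ** A = mat 1"
    using assms BA by blast
  have *: "A ** matrix_inv A = mat 1 \<and> matrix_inv A ** A = mat 1"
    unfolding matrix_inv_def by (rule someI_ex[OF ex])
  have "matrix_inv A = (B ** A) ** matrix_inv A"
    by (simp add: BA)
  also have "\<dots> = B"
    using * by (simp flip: matrix_mul_assoc)
  finally show ?thesis .
qed

lemma matrix_inv_mult_right:
  fixes A :: "real^'n^'n"
  assumes "invertible A"
  shows "A ** matrix_inv A = mat 1"
  using assms matrix_inv_eqI unfolding invertible_def by metis

lemma matrix_inv_mult_left: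
  fixes A :: "real^'n^'n"
  assumes "invertible A"
  shows "matrix_inv A ** A = mat 1"
  using matrix_inv_mult_right[OF assms] by (simp add: matrix_left_right_inverse)

lemma matrix_inv_vector_right:
  fixes A :: "real^'n^'n"
  assumes "invertible A"
  shows "A *v (matrix_inv A *v x) = x"
  using matrix_inv_mult_right[OF assms] by (simp add: matrix_vector_mul_assoc)

lemma matrix_inv_vector_left:
  fixes A :: "real^'n^'n"
  assumes "invertible A"
  shows "matrix_inv A *v (A *v x) = x"
  using matrix_inv_mult_left[OF assms] by (simp add: matrix_vector_mul_assoc)

lemma matrix_inv_matrix_inv:
  fixes A :: "real^'n^'n"
  assumes "invertible A"
  shows "matrix_inv (matrix_inv A) = A"
  by (rule matrix_inv_eqI) (rule matrix_inv_mult_left[OF assms])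

lemma matrix_inv_scaleR:
  fixes A :: "real^'n^'n"
  assumes "invertible A" "c \<noteq> 0"
  shows "matrix_inv (c *\<^sub>R A) = (1 / c) *\<^sub>R matrix_inv A"
  by (rule matrix_inv_eqI)
     (use assms in \<open>simp add: matrix_scalar_ac(1) scalar_matrix_assoc matrix_inv_mult_right flip: scalar_matrix_assoc\<close>)

lemma transpose_matrix_inv:
  fixes A :: "real^'n^'n"
  assumes "invertible A"
  shows "transpose (matrix_inv A) = matrix_inv (transpose A)"
proof (rule matrix_inv_eqI[symmetric])
  show "transpose A ** transpose (matrix_inv A) = mat 1"
    using matrix_inv_mult_left[OF assms] by (metis matrix_transpose_mul transpose_mat)
qed

lemma inner_matrix_transpose:
  fixes A :: "real^'n^'m"
  shows "x \<bullet> (A *v y) = (transpose A *v x) \<bullet> y"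
  by (simp add: dot_lmul_matrix)

lemma sym_pos_def_symmetric: "sym_pos_def Q \<Longrightarrow> transpose Q = Q"
  by (simp add: sym_pos_def_def)

lemma sym_pos_def_inner_commute: "sym_pos_def Q \<Longrightarrow> x \<bullet> (Q *v y) = (Q *v x) \<bullet> y"
  by (simp only: inner_matrix_transpose sym_pos_def_symmetric)

lemma sym_pos_def_pos: "sym_pos_def Q \<Longrightarrow> x \<noteq> 0 \<Longrightarrow> 0 < x \<bullet> (Q *v x)"
  by (simp add: sym_pos_def_def)

lemma sym_pos_def_invertible:
  assumes "sym_pos_def Q"
  shows "invertible Q"
proof -
  have "\<forall>x. Q *v x = 0 \<longrightarrow> x = 0"
    using sym_pos_def_pos[OF assms] by fastforce
  then show ?thesis
    by (simp add: invertible_left_inverse matrix_left_invertible_ker)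
qed

lemma sym_pos_def_add:
  assumes "sym_pos_def A" "sym_pos_def B"
  shows "sym_pos_def (A + B)"
  using assms unfolding sym_pos_def_def
  by (auto simp: transpose_def vec_eq_iff matrix_vector_mult_add_rdistrib inner_add_right add_pos_pos)

lemma sym_pos_def_scaleR:
  assumes "sym_pos_def A" "c > 0"
  shows "sym_pos_def (c *\<^sub>R A)"
  using assms unfolding sym_pos_def_def
  by (auto simp: transpose_def vec_eq_iff simp flip: scaleR_matrix_vector_assoc)

lemma sym_pos_def_matrix_inv:
  fixes A :: "real^'n^'n"
  assumes "sym_pos_def A"
  shows "sym_pos_def (matrix_inv A)"
  unfolding sym_pos_def_def
proof (intro conjI allI impI)
  note inv = sym_pos_def_invertible[OF assms]
  show "transpose (matrix_inv A) = matrix_inv A"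
    by (simp add: transpose_matrix_inv inv sym_pos_def_symmetric[OF assms])
  fix x :: "real^'n" assume "x \<noteq> 0"
  then have "matrix_inv A *v x \<noteq> 0"
    using matrix_inv_vector_right[OF inv, of x] by fastforce
  from sym_pos_def_pos[OF assms this] show "0 < x \<bullet> (matrix_inv A *v x)"
    by (simp add: matrix_inv_vector_right inv inner_commute)
qed

text \<open>
  Gram-Schmidt for the inner product \<open>x \<bullet> Q y\<close>: as long as fewer than \<open>CARD('n)\<close> vectors have been
  chosen, their images under \<open>Q\<close> span a proper subspace, and any vector Euclidean-orthogonal to
  that subspace is \<open>Q\<close>-orthogonal to all of them.
\<close>

lemma conjugate_orthonormal_extend:
  fixes Q :: "real^'n^'n"
  assumes Q: "sym_pos_def Q" and "k \<le> CARD('n)"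
  shows "\<exists>S. finite S \<and> card S = k \<and> (\<forall>x\<in>S. \<forall>y\<in>S. x \<bullet> (Q *v y) = of_bool (x = y))"
  using \<open>k \<le> CARD('n)\<close>
proof (induction k)
  case (Suc k)
  then obtain S where S: "finite S" "card S = k"
    "\<forall>x\<in>S. \<forall>y\<in>S. x \<bullet> (Q *v y) = of_bool (x = y)" by auto
  have "dim ((*v) Q ` S) \<le> card ((*v) Q ` S)"
    using S(1) by (simp add: dim_le_card')
  also have "\<dots> \<le> k"
    using card_image_le[OF S(1)] S(2) by simp
  also have "\<dots> < DIM(real^'n)"
    using Suc.prems by simp
  finally obtain v where v: "v \<noteq> 0" "\<And>y. y \<in> span ((*v) Q ` S) \<Longrightarrow> orthogonal v y"
    using orthogonal_to_subspace_exists by blast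
  define r where "r = v \<bullet> (Q *v v)"
  have r: "r > 0" unfolding r_def by (rule sym_pos_def_pos[OF Q v(1)])
  define w where "w = (1 / sqrt r) *\<^sub>R v"
  have vS: "v \<bullet> (Q *v y) = 0" if "y \<in> S" for y
    using v(2)[of "Q *v y"] that by (auto simp: orthogonal_def span_base)
  have wS: "w \<bullet> (Q *v y) = 0" if "y \<in> S" for y
    using vS[OF that] by (simp add: w_def)
  have Sw: "y \<bullet> (Q *v w) = 0" if "y \<in> S" for y
    using wS[OF that] sym_pos_def_inner_commute[OF Q, of y w] by (simp add: inner_commute)
  have ww: "w \<bullet> (Q *v w) = 1"
    using r by (simp add: w_def matrix_vector_mult_scaleR flip: r_def)
  have "w \<notin> S" using wS[of w] ww by auto
  then have "card (insert w S) = Suc k" using S by simp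
  moreover have "\<forall>x\<in>insert w S. \<forall>y\<in>insert w S. x \<bullet> (Q *v y) = of_bool (x = y)"
    using S(3) wS Sw ww \<open>w \<notin> S\<close> by auto
  ultimately show ?case using S(1) by blast
qed (auto intro!: exI[of _ "{}"])

lemma matrix_congruence_entry:
  fixes B :: "real^'n^'m" and P :: "real^'m^'m"
  shows "(transpose B ** P ** B) $ i $ j = column i B \<bullet> (P *v column j B)"
proof -
  have "(transpose B ** P ** B) $ i $ j = axis i 1 \<bullet> ((transpose B ** P ** B) *v axis j 1)"
    unfolding matrix_vector_mult_basis by (simp add: inner_axis' column_def)
  also have "\<dots> = (transpose (transpose B) *v axis i 1) \<bullet> (P *v (B *v axis j 1))"
    by (simp only: inner_matrix_transpose[of _ "transpose B"] matrix_vector_mul_assoc[symmetric])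
  also have "\<dots> = column i B \<bullet> (P *v column j B)"
    by (simp add: matrix_vector_mult_basis)
  finally show ?thesis .
qed

text \<open>
  The columns of \<open>B\<close> are a \<open>Q\<close>-orthonormal basis. Such a \<open>B\<close> serves below in place of \<open>Q\<^sup>-\<^sup>1\<^sup>/\<^sup>2\<close>:
  in the coordinates \<open>B\<^sup>-\<^sup>1 x\<close>, the distribution \<open>N(0, Q\<^sup>-\<^sup>1)\<close> is the standard Gaussian one.
\<close>

lemma sym_pos_def_whitening:
  fixes Q :: "real^'n^'n"
  assumes Q: "sym_pos_def Q"
  obtains B :: "real^'n^'n" where "transpose B ** Q ** B = mat 1"
proof -
  obtain S where S: "finite S" "card S = CARD('n)"
    "\<forall>x\<in>S. \<forall>y\<in>S. x \<bullet> (Q *v y) = of_bool (x = y)"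
    using conjugate_orthonormal_extend[OF Q order.refl] by blast
  then obtain f :: "'n \<Rightarrow> real^'n" where f: "bij_betw f UNIV S"
    using finite_same_card_bij[of "UNIV :: 'n set" S] by auto
  define B :: "real^'n^'n" where "B = matrix_of_columns f"
  have col: "column i B = f i" for i
    by (simp add: B_def matrix_of_columns_def column_def)
  have "transpose B ** Q ** B = mat 1"
    unfolding vec_eq_iff matrix_congruence_entry col
    using S(3) f by (auto simp: mat_def bij_betw_def inj_on_def)
  then show ?thesis by (rule that)
qed

lemma whitening_invertible:
  fixes B Q :: "real^'n^'n"
  assumes "transpose B ** Q ** B = mat 1"
  shows "invertible B"
  using assms invertible_left_inverse by blast

lemma whitening_det:
  fixes B Q :: "real^'n^'n"
  assumes "transpose B ** Q ** B = mat 1"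
  shows "det Q * (det B)\<^sup>2 = 1"
proof -
  have "det (transpose B ** Q ** B) = 1" using assms by simp
  then show ?thesis by (simp add: det_mul power2_eq_square mult_ac)
qed

lemma whitening_eq:
  fixes B Q :: "real^'n^'n"
  assumes "transpose B ** Q ** B = mat 1"
  shows "Q = transpose (matrix_inv B) ** matrix_inv B"
proof -
  note inv = whitening_invertible[OF assms]
  have T: "transpose (matrix_inv B) ** transpose B = mat 1"
    using matrix_inv_mult_right[OF inv] by (metis matrix_transpose_mul transpose_mat)
  have "Q = (transpose (matrix_inv B) ** transpose B) ** Q ** (B ** matrix_inv B)"
    by (simp add: T matrix_inv_mult_right inv)
  also have "\<dots> = transpose (matrix_inv B) ** (transpose B ** Q ** B) ** matrix_inv B"
    by (simp add: matrix_mul_assoc)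
  finally show ?thesis by (simp add: assms)
qed

lemma whitening_inner:
  fixes B Q :: "real^'n^'n"
  assumes "transpose B ** Q ** B = mat 1"
  shows "x \<bullet> (Q *v x) = (matrix_inv B *v x) \<bullet> (matrix_inv B *v x)"
  by (subst whitening_eq[OF assms])
     (simp only: inner_matrix_transpose[of _ "transpose _"] transpose_transpose
       matrix_vector_mul_assoc[symmetric])

text \<open>
  A \<open>Q\<close>-orthonormal basis turns \<open>x \<bullet> Q x\<close> into a sum of squares. Positive definiteness of the prior
  and posterior precisions is obtained from explicit bases in this way.
\<close>

lemma sym_pos_def_of_whitening:
  fixes B Q :: "real^'n^'n"
  assumes "transpose B ** Q ** B = mat 1"
  shows "sym_pos_def Q"
  unfolding sym_pos_def_def
proof (intro conjI allI impI)
  note inv = whitening_invertible[OF assms]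
  show "transpose Q = Q"
    by (subst (1 2) whitening_eq[OF assms]) (simp add: matrix_transpose_mul)
  fix x :: "real^'n" assume "x \<noteq> 0"
  then have "matrix_inv B *v x \<noteq> 0"
    using matrix_inv_vector_right[OF inv, of x] by fastforce
  then show "0 < x \<bullet> (Q *v x)"
    by (simp add: whitening_inner[OF assms])
qed

lemma sym_pos_def_det_pos: "sym_pos_def Q \<Longrightarrow> det Q > 0"
  by (metis sym_pos_def_whitening whitening_det zero_less_mult_pos2 zero_less_one
      zero_less_power2 mult_zero_right zero_neq_one power_zero_numeral)

lemma det_matrix_inv:
  fixes Q :: "real^'n^'n"
  assumes "invertible Q"
  shows "det (matrix_inv Q) = 1 / det Q"
  using matrix_inv_mult_right[OF assms] by (metis det_I det_mul nonzero_mult_div_cancel_left mult_zero_left zero_neq_one)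

section \<open>Linear change of variables for Lebesgue measure\<close>

lemma vec_lambda_measurable [measurable]:
  "(vec_lambda :: ('n::finite \<Rightarrow> real) \<Rightarrow> real^'n) \<in> borel_measurable (PiM UNIV (\<lambda>_. borel))"
  by (subst borel_measurable_euclidean_space) (auto simp: Basis_vec_def inner_axis)

lemma vec_nth_measurable [measurable]: "(\<lambda>x::real^'n. x $ i) \<in> borel_measurable borel"
  by (intro borel_measurable_continuous_onI continuous_intros)

lemma matrix_vector_mult_measurable [measurable]: "((*v) A :: real^'n \<Rightarrow> real^'m) \<in> borel_measurable borel"
  by (intro borel_measurable_continuous_onI continuous_intros)

lemma lborel_vec:
  "lborel = distr (PiM UNIV (\<lambda>_. lborel)) borel (vec_lambda :: ('n::finite \<Rightarrow> real) \<Rightarrow> real^'n)"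
proof (rule lborel_eqI)
  interpret product_sigma_finite "\<lambda>_::'n. lborel :: real measure" ..
  fix l u :: "real^'n" assume "\<And>b. b \<in> Basis \<Longrightarrow> l \<bullet> b \<le> u \<bullet> b"
  then have le: "l $ i \<le> u $ i" for i
    by (metis axis_in_Basis_iff inner_axis inner_real_def mult.right_neutral Basis_real_def singletonI)
  have "vec_lambda -` box l u \<inter> space (PiM UNIV (\<lambda>_::'n. lborel :: real measure))
      = (\<Pi>\<^sub>E i\<in>UNIV. {l $ i <..< u $ i})"
    by (auto simp: mem_box_cart space_PiM PiE_UNIV_domain Pi_iff)
  then have "emeasure (distr (PiM UNIV (\<lambda>_. lborel)) borel vec_lambda) (box l u)
      = (\<Prod>i\<in>UNIV. ennreal (u $ i - l $ i))"
    using le by (subst emeasure_distr) (auto simp: emeasure_PiM)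
  also have "\<dots> = ennreal (\<Prod>i\<in>UNIV. u $ i - l $ i)"
    using le by (intro prod_ennreal) simp
  also have "(\<Prod>i\<in>UNIV. u $ i - l $ i) = (\<Prod>b\<in>Basis. (u - l) \<bullet> b)"
  proof -
    have B: "(Basis :: (real^'n) set) = (\<lambda>i. axis i 1) ` UNIV" by (auto simp: Basis_vec_def)
    show ?thesis unfolding B
      by (subst prod.reindex) (auto simp: inner_axis inj_on_def axis_eq_axis)
  qed
  finally show "emeasure (distr (PiM UNIV (\<lambda>_. lborel)) borel vec_lambda) (box l u)
    = (\<Prod>b\<in>Basis. (u - l) \<bullet> b)" .
qed simp

lemma nn_integral_lborel_vec:
  fixes f :: "real^'n \<Rightarrow> ennreal"
  assumes [measurable]: "f \<in> borel_measurable borel"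
  shows "(\<integral>\<^sup>+x. f x \<partial>lborel) = (\<integral>\<^sup>+x. f (vec_lambda x) \<partial>PiM UNIV (\<lambda>_. lborel))"
  by (subst lborel_vec, subst nn_integral_distr) auto

text \<open>
  By Fubini, the coordinate \<open>m\<close> may be integrated first; for fixed remaining coordinates the shear only
  translates it by the constant \<open>c * x $ n\<close>.
\<close>

lemma nn_integral_lborel_shear:
  fixes f :: "real^'n \<Rightarrow> ennreal"
  assumes [measurable]: "f \<in> borel_measurable borel" and "m \<noteq> n"
  shows "(\<integral>\<^sup>+x. f (\<chi> i. if i = m then x $ m + c * x $ n else x $ i) \<partial>lborel) = (\<integral>\<^sup>+x. f x \<partial>lborel)"
proof -
  interpret product_sigma_finite "\<lambda>_::'n. lborel :: real measure" ..
  let ?I = "UNIV - {m}"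
  have ins: "insert m ?I = UNIV" by auto
  have split: "(\<integral>\<^sup>+x. h x \<partial>lborel) = (\<integral>\<^sup>+x. \<integral>\<^sup>+y. h (vec_lambda (x(m := y))) \<partial>lborel \<partial>PiM ?I (\<lambda>_. lborel))"
    if [measurable]: "h \<in> borel_measurable borel" for h :: "real^'n \<Rightarrow> ennreal"
    using product_nn_integral_insert[of ?I m "\<lambda>x. h (vec_lambda x)"]
    unfolding ins by (simp add: nn_integral_lborel_vec)
  let ?S = "\<lambda>x::real^'n. (\<chi> i. if i = m then x $ m + c * x $ n else x $ i) :: real^'n"
  have [measurable]: "?S \<in> borel_measurable borel"
    by (subst borel_measurable_euclidean_space) (auto simp: Basis_vec_def inner_axis)
  have "(\<integral>\<^sup>+x. f (?S x) \<partial>lborel)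
      = (\<integral>\<^sup>+x. \<integral>\<^sup>+y. f (?S (vec_lambda (x(m := y)))) \<partial>lborel \<partial>PiM ?I (\<lambda>_. lborel))"
    by (rule split) simp
  also have "\<dots> = (\<integral>\<^sup>+x. \<integral>\<^sup>+y. f (vec_lambda (x(m := y))) \<partial>lborel \<partial>PiM ?I (\<lambda>_. lborel))"
  proof (rule nn_integral_cong)
    fix x assume x: "x \<in> space (PiM ?I (\<lambda>_. lborel :: real measure))"
    have upd: "vec_lambda (x(m := c * x n + 1 * y)) = ?S (vec_lambda (x(m := y)))" for y
      using \<open>m \<noteq> n\<close> by (auto simp: vec_eq_iff)
    have [measurable]: "(\<lambda>y. f (vec_lambda (x(m := y)))) \<in> borel_measurable borel"
    proof -
      have "(\<lambda>y. vec_lambda (x(m := y)) :: real^'n) \<in> borel_measurable borel"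
        by (subst borel_measurable_euclidean_space) (auto simp: Basis_vec_def inner_axis)
      then show ?thesis by measurable
    qed
    show "(\<integral>\<^sup>+y. f (?S (vec_lambda (x(m := y)))) \<partial>lborel) = (\<integral>\<^sup>+y. f (vec_lambda (x(m := y))) \<partial>lborel)"
      using nn_integral_real_affine[of "\<lambda>y. f (vec_lambda (x(m := y)))" 1 "c * x n"]
      by (simp add: upd[simplified])
  qed
  also have "\<dots> = (\<integral>\<^sup>+x. f x \<partial>lborel)"
    by (rule split[symmetric]) simp
  finally show ?thesis .
qed

text \<open>
  Both sides are multiplicative in \<open>A\<close>, so it suffices to treat elementary matrices: diagonal ones
  scale boxes, transpositions permute their sides, and row additions are shears.
\<close>

lemma nn_integral_lborel_matrix:
  fixes A :: "real^'n^'n" and f :: "real^'n \<Rightarrow> ennreal"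
  assumes "det A \<noteq> 0" and "f \<in> borel_measurable borel"
  shows "ennreal \<bar>det A\<bar> * (\<integral>\<^sup>+x. f (A *v x) \<partial>lborel) = (\<integral>\<^sup>+x. f x \<partial>lborel)"
proof -
  have "det A \<noteq> 0 \<longrightarrow> (\<forall>f\<in>borel_measurable borel.
      ennreal \<bar>det A\<bar> * (\<integral>\<^sup>+x. f (A *v x) \<partial>lborel) = (\<integral>\<^sup>+x. f x \<partial>lborel))" (is "?P A")
  proof (induction A rule: induct_matrix_elementary)
    case (1 A B)
    show ?case
    proof (intro impI ballI)
      fix f :: "real^'n \<Rightarrow> ennreal"
      assume nz: "det (A ** B) \<noteq> 0" and f[measurable]: "f \<in> borel_measurable borel"
      then have nz: "det A \<noteq> 0" "det B \<noteq> 0" by (auto simp: det_mul)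
      have fA: "(\<lambda>x. f (A *v x)) \<in> borel_measurable borel" by measurable
      have "ennreal \<bar>det (A ** B)\<bar> * (\<integral>\<^sup>+x. f ((A ** B) *v x) \<partial>lborel)
          = ennreal \<bar>det A\<bar> * (ennreal \<bar>det B\<bar> * (\<integral>\<^sup>+x. f (A *v (B *v x)) \<partial>lborel))"
        by (simp add: det_mul abs_mult ennreal_mult mult.assoc matrix_vector_mul_assoc)
      also have "\<dots> = (\<integral>\<^sup>+x. f x \<partial>lborel)"
        using bspec[OF mp[OF 1(2) nz(2)] fA] bspec[OF mp[OF 1(1) nz(1)] f] by simp
      finally show "ennreal \<bar>det (A ** B)\<bar> * (\<integral>\<^sup>+x. f ((A ** B) *v x) \<partial>lborel) = (\<integral>\<^sup>+x. f x \<partial>lborel)" .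
    qed
  next
    \<comment> \<open>A matrix with a zero row is singular.\<close>
    case (2 A i)
    then show ?case by (simp add: det_zero_row)
  next
    case (3 A)
    show ?case
    proof (intro impI ballI)
      fix f :: "real^'n \<Rightarrow> ennreal"
      assume nz: "det A \<noteq> 0" and f[measurable]: "f \<in> borel_measurable borel"
      have det: "det A = (\<Prod>i\<in>UNIV. A $ i $ i)"
        by (rule det_diagonal) (rule 3)
      \<comment> \<open>The affine change of variables takes its scale factors indexed by basis vectors;
        \<open>c\<close> transfers the diagonal of \<open>A\<close> to that indexing.\<close>
      define c where "c b = (THE r. \<forall>i. b = axis i 1 \<longrightarrow> r = A $ i $ i)" for b :: "real^'n"
      have c: "c (axis i 1) = A $ i $ i" for i
        unfolding c_def by (rule the_equality) (auto simp: axis_eq_axis)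
      have B: "(Basis :: (real^'n) set) = (\<lambda>i. axis i 1) ` UNIV" by (auto simp: Basis_vec_def)
      have inj: "inj (\<lambda>i::'n. axis i (1::real))" by (auto simp: inj_on_def axis_eq_axis)
      have prod: "(\<Prod>b\<in>Basis. \<bar>c b\<bar>) = \<bar>det A\<bar>"
        unfolding B det by (simp add: prod.reindex inj c abs_prod)
      have T: "0 + (\<Sum>j\<in>Basis. (c j * (x \<bullet> j)) *\<^sub>R j) = A *v x" for x
      proof -
        have "(0 + (\<Sum>j\<in>Basis. (c j * (x \<bullet> j)) *\<^sub>R j)) = (\<Sum>i\<in>UNIV. (A $ i $ i * x $ i) *\<^sub>R axis i 1)"
          unfolding B by (simp add: sum.reindex inj c inner_axis)
        also have "\<dots> = A *v x"
        proof (subst vec_eq_iff, rule allI)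
          fix k
          have "(A *v x) $ k = (\<Sum>j\<in>UNIV. if j = k then A $ k $ k * x $ k else 0)"
            unfolding matrix_vector_mult_def vec_lambda_beta by (rule sum.cong) (auto simp: 3)
          moreover have "(\<Sum>i\<in>UNIV. (A $ i $ i * x $ i) *\<^sub>R axis i 1) $ k
              = (\<Sum>j\<in>UNIV. if j = k then A $ k $ k * x $ k else 0)"
            unfolding sum_component vector_scaleR_component
            by (rule sum.cong) (auto simp: axis_def)
          ultimately show "(\<Sum>i\<in>UNIV. (A $ i $ i * x $ i) *\<^sub>R axis i 1) $ k = (A *v x) $ k" by simp
        qed
        finally show ?thesis .
      qed
      have "c j \<noteq> 0" if "j \<in> Basis" for j
        using that nz unfolding B det by (auto simp: c)
      from lborel_affine_euclidean[of c 0, OF this]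
      have "(lborel :: (real^'n) measure) = density (distr lborel borel ((*v) A)) (\<lambda>_. ennreal \<bar>det A\<bar>)"
        unfolding T prod .
      then have "(\<integral>\<^sup>+x. f x \<partial>lborel) = (\<integral>\<^sup>+x. f x \<partial>density (distr lborel borel ((*v) A)) (\<lambda>_. ennreal \<bar>det A\<bar>))"
        by simp
      also have "\<dots> = ennreal \<bar>det A\<bar> * (\<integral>\<^sup>+x. f (A *v x) \<partial>lborel)"
        by (simp add: nn_integral_density nn_integral_distr nn_integral_cmult)
      finally show "ennreal \<bar>det A\<bar> * (\<integral>\<^sup>+x. f (A *v x) \<partial>lborel) = (\<integral>\<^sup>+x. f x \<partial>lborel)" ..
    qed
  next
    case (4 m n)
    \<comment> \<open>Exchanging two coordinates maps boxes to boxes of the same volume.\<close>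
    let ?p = "Transposition.transpose m n"
    let ?A = "(\<chi> i j. mat 1 $ i $ ?p j) :: real^'n^'n"
    have p: "?p permutes UNIV" by (simp add: permutes_swap_id)
    have detA: "\<bar>det ?A\<bar> = 1"
      by (simp add: det_permute_columns p sign_swap_id abs_mult 4)
    have A: "?A *v x = (\<chi> i. x $ ?p i)" for x
    proof (subst vec_eq_iff, rule allI)
      fix i
      have "(?A *v x) $ i = (\<Sum>j\<in>UNIV. if j = ?p i then x $ ?p i else 0)"
        unfolding matrix_vector_mult_def vec_lambda_beta
        by (rule sum.cong) (auto simp: mat_def)
      then show "(?A *v x) $ i = (\<chi> i. x $ ?p i) $ i" by simp
    qed
    show ?case
    proof (intro impI ballI)
      fix f :: "real^'n \<Rightarrow> ennreal"
      assume f[measurable]: "f \<in> borel_measurable borel"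
      have "(lborel :: (real^'n) measure) = distr lborel borel ((*v) ?A)"
      proof (rule lborel_eqI)
        fix l u :: "real^'n" assume "\<And>b. b \<in> Basis \<Longrightarrow> l \<bullet> b \<le> u \<bullet> b"
        then have le: "l $ i \<le> u $ i" for i
          by (metis axis_in_Basis_iff inner_axis inner_real_def mult.right_neutral Basis_real_def singletonI)
        have B: "(Basis :: (real^'n) set) = (\<lambda>i. axis i 1) ` UNIV" by (auto simp: Basis_vec_def)
        have P: "(\<Prod>b\<in>Basis. (v :: real^'n) \<bullet> b) = (\<Prod>i\<in>UNIV. v $ i)" for v
          unfolding B by (subst prod.reindex) (auto simp: inner_axis inj_on_def axis_eq_axis)
        have vim: "((*v) ?A) -` box l u = box (\<chi> i. l $ ?p i) (\<chi> i. u $ ?p i)"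
          by (auto simp: A mem_box_cart) (metis transpose_involutory)+
        have leb: "(\<chi> i. l $ ?p i) \<bullet> b \<le> (\<chi> i. u $ ?p i) \<bullet> b" if "b \<in> Basis" for b
          using that le unfolding B by (auto simp: inner_axis)
        have "emeasure (distr lborel borel ((*v) ?A)) (box l u)
            = (\<Prod>i\<in>UNIV. u $ ?p i - l $ ?p i)"
          by (subst emeasure_distr) (auto simp: vim emeasure_lborel_box[OF leb] P)
        also have "(\<Prod>i\<in>UNIV. u $ ?p i - l $ ?p i) = (\<Prod>b\<in>Basis. (u - l) \<bullet> b)"
          unfolding P using prod.permute[OF p, of "\<lambda>i. (u - l) $ i"] by (simp add: o_def)
        finally show "emeasure (distr lborel borel ((*v) ?A)) (box l u) = (\<Prod>b\<in>Basis. (u - l) \<bullet> b)" .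
      qed simp
      then have "(\<integral>\<^sup>+x. f x \<partial>lborel) = (\<integral>\<^sup>+x. f x \<partial>distr lborel borel ((*v) ?A))"
        by simp
      also have "\<dots> = (\<integral>\<^sup>+x. f (?A *v x) \<partial>lborel)"
        by (simp add: nn_integral_distr)
      finally show "ennreal \<bar>det ?A\<bar> * (\<integral>\<^sup>+x. f (?A *v x) \<partial>lborel) = (\<integral>\<^sup>+x. f x \<partial>lborel)"
        unfolding detA by simp
    qed
  next
    case (5 m n c)
    \<comment> \<open>Adding a multiple of one coordinate to another is a shear.\<close>
    let ?A = "(\<chi> i j. if i = m \<and> j = n then c else of_bool (i = j)) :: real^'n^'n"
    have "?A = (\<chi> k. if k = m then row m (mat 1) + c *s row n (mat 1) else row k (mat 1))"
      using 5 by (auto simp: vec_eq_iff row_def mat_def)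
    then have detA: "det ?A = 1"
      using det_row_operation[OF 5, of "mat 1" c] by simp
    have A: "?A *v x = (\<chi> i. if i = m then x $ m + c * x $ n else x $ i)" for x
    proof (subst vec_eq_iff, rule allI)
      fix i
      have "(?A *v x) $ i = (\<Sum>j\<in>UNIV. (if j = i then x $ i else 0) + (if j = n then (if i = m then c * x $ n else 0) else 0))"
        unfolding matrix_vector_mult_def vec_lambda_beta using 5 by (intro sum.cong) auto
      also have "\<dots> = x $ i + (if i = m then c * x $ n else 0)"
        unfolding sum.distrib by simp
      finally show "(?A *v x) $ i = (\<chi> i. if i = m then x $ m + c * x $ n else x $ i) $ i" by simp
    qed
    show ?case
      unfolding detA A using nn_integral_lborel_shear[OF _ 5] by simp
  qed
  then show ?thesis using assms by blast
qed

lemma distributed_affine_vec: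
  fixes X :: "'w \<Rightarrow> real^'n" and A :: "real^'n^'n"
  assumes X: "distributed M lborel X f" and A: "invertible A"
  shows "distributed M lborel (\<lambda>\<omega>. c + A *v X \<omega>)
           (\<lambda>x. ennreal (1 / \<bar>det A\<bar>) * f (matrix_inv A *v (x - c)))"
proof -
  have f[measurable]: "f \<in> borel_measurable borel"
    using distributed_borel_measurable[OF X] by simp
  have Xm[measurable]: "X \<in> borel_measurable M"
    using distributed_measurable[OF X] by simp
  have det: "det A \<noteq> 0" using A by (simp add: invertible_det_nz)
  let ?g = "\<lambda>x. ennreal (1 / \<bar>det A\<bar>) * f (matrix_inv A *v (x - c))"
  have [measurable]: "?g \<in> borel_measurable borel" by measurable
  have "distr M lborel (\<lambda>\<omega>. c + A *v X \<omega>) = density lborel ?g"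
  proof (rule measure_eqI)
    fix S assume "S \<in> sets (distr M lborel (\<lambda>\<omega>. c + A *v X \<omega>))"
    then have S[measurable]: "S \<in> sets borel" by simp
    have "emeasure (density lborel ?g) S = (\<integral>\<^sup>+x. ?g x * indicator S x \<partial>lborel)"
      by (simp add: emeasure_density)
    also have "\<dots> = (\<integral>\<^sup>+x. ?g (c + x) * indicator S (c + x) \<partial>lborel)"
    proof -
      have "(lborel :: (real^'n) measure) = distr lborel borel ((+) c)"
        using lborel_affine[of 1 c] by (simp add: density_1)
      then have "(\<integral>\<^sup>+x. ?g x * indicator S x \<partial>lborel)
          = (\<integral>\<^sup>+x. ?g x * indicator S x \<partial>distr lborel borel ((+) c))"
        by simp
      then show ?thesis by (simp add: nn_integral_distr)
    qed
    also have "\<dots> = ennreal \<bar>det A\<bar> * (\<integral>\<^sup>+x. ?g (c + A *v x) * indicator S (c + A *v x) \<partial>lborel)"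
      by (rule nn_integral_lborel_matrix[OF det, symmetric, where f="\<lambda>x. ?g (c + x) * indicator S (c + x)"]) simp
    also have "\<dots> = (\<integral>\<^sup>+x. ennreal \<bar>det A\<bar> * (?g (c + A *v x) * indicator S (c + A *v x)) \<partial>lborel)"
      by (rule nn_integral_cmult[symmetric]) simp
    also have "\<dots> = (\<integral>\<^sup>+x. f x * indicator S (c + A *v x) \<partial>lborel)"
    proof (rule nn_integral_cong)
      fix x :: "real^'n"
      have "ennreal \<bar>det A\<bar> * ennreal (1 / \<bar>det A\<bar>) = 1"
        using det by (subst ennreal_mult[symmetric]) auto
      then show "ennreal \<bar>det A\<bar> * (?g (c + A *v x) * indicator S (c + A *v x)) = f x * indicator S (c + A *v x)"
        by (simp add: matrix_inv_vector_left A flip: mult.assoc)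
    qed
    also have "\<dots> = (\<integral>\<^sup>+\<omega>. indicator S (c + A *v X \<omega>) \<partial>M)"
      by (rule distributed_nn_integral[OF X]) simp
    also have "\<dots> = emeasure (distr M lborel (\<lambda>\<omega>. c + A *v X \<omega>)) S"
      by (simp add: nn_integral_distr flip: nn_integral_indicator)
    finally show "emeasure (distr M lborel (\<lambda>\<omega>. c + A *v X \<omega>)) S = emeasure (density lborel ?g) S" ..
  qed simp
  then show ?thesis unfolding distributed_def by simp
qed

section \<open>Gaussian vectors composed of independent blocks\<close>

text \<open>
  The quadratic form becomes \<open>|B\<^sup>-\<^sup>1 (x - c)|\<^sup>2\<close>, and \<open>det Q\<^sup>-\<^sup>1 = (det B)\<^sup>2\<close>, so the normalising constant
  changes by exactly the Jacobian of \<open>x \<mapsto> c + B x\<close>.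
\<close>

lemma gaussian_density_whitened:
  fixes B Q :: "real^'n^'n"
  assumes B: "transpose B ** Q ** B = mat 1"
  shows "gaussian_density c (matrix_inv Q) x
       = 1 / \<bar>det B\<bar> * gaussian_density 0 (mat 1) (matrix_inv B *v (x - c))"
proof -
  note spd = sym_pos_def_of_whitening[OF B]
  have "det (matrix_inv Q) = (det B)\<^sup>2"
    using whitening_det[OF B] sym_pos_def_det_pos[OF spd]
    by (simp add: det_matrix_inv sym_pos_def_invertible[OF spd] field_simps)
  then have "sqrt ((2 * pi) ^ CARD('n) * det (matrix_inv Q)) = sqrt ((2 * pi) ^ CARD('n)) * \<bar>det B\<bar>"
    by (simp add: real_sqrt_mult)
  moreover have "matrix_inv (mat 1 :: real^'n^'n) = mat 1"
    by (rule matrix_inv_eqI) simp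
  ultimately show ?thesis
    unfolding gaussian_density_def matrix_inv_matrix_inv[OF sym_pos_def_invertible[OF spd]]
    by (simp add: whitening_inner[OF B])
qed

lemma gaussian_density_nonneg: "det C \<ge> 0 \<Longrightarrow> 0 \<le> gaussian_density c C x"
  by (simp add: gaussian_density_def)

lemma distributed_gaussian_of_standard:
  fixes B Q :: "real^'n^'n"
  assumes B: "transpose B ** Q ** B = mat 1"
    and X: "distributed M lborel X (gaussian_density 0 (mat 1))"
  shows "distributed M lborel (\<lambda>\<omega>. c + B *v X \<omega>) (gaussian_density c (matrix_inv Q))"
proof -
  have "ennreal (gaussian_density c (matrix_inv Q) x)
      = ennreal (1 / \<bar>det B\<bar>) * ennreal (gaussian_density 0 (mat 1) (matrix_inv B *v (x - c)))" for x
    unfolding gaussian_density_whitened[OF B] by (rule ennreal_mult) (simp_all add: gaussian_density_nonneg)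
  then show ?thesis
    using distributed_affine_vec[OF X whitening_invertible[OF B], of c] by simp
qed

lemma distributed_standard_of_gaussian:
  fixes B Q :: "real^'n^'n"
  assumes B: "transpose B ** Q ** B = mat 1"
    and X: "distributed M lborel X (gaussian_density 0 (matrix_inv Q))"
  shows "distributed M lborel (\<lambda>\<omega>. matrix_inv B *v X \<omega>) (gaussian_density 0 (mat 1))"
proof -
  note inv = whitening_invertible[OF B]
  have inv': "invertible (matrix_inv B)"
    using matrix_inv_mult_left[OF inv] matrix_inv_mult_right[OF inv] unfolding invertible_def by blast
  have det: "det B \<noteq> 0" using inv by (simp add: invertible_det_nz)
  have "ennreal (1 / \<bar>det (matrix_inv B)\<bar>) * ennreal (gaussian_density 0 (matrix_inv Q) (B *v x))
      = ennreal (gaussian_density 0 (mat 1) x)" for x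
    using det unfolding gaussian_density_whitened[OF B]
    by (simp add: det_matrix_inv inv matrix_inv_vector_left gaussian_density_nonneg flip: ennreal_mult)
  then show ?thesis
    using distributed_affine_vec[OF X inv', of 0]
    by (simp add: matrix_inv_matrix_inv inv)
qed

abbreviation std_normal :: "real measure" where
  "std_normal \<equiv> density lborel (\<lambda>x. ennreal (std_normal_density x))"

lemma standard_gaussian_density_prod:
  fixes x :: "real^'n"
  shows "gaussian_density 0 (mat 1) x = (\<Prod>i\<in>UNIV. std_normal_density (x $ i))"
proof -
  have mat: "matrix_inv (mat 1 :: real^'n^'n) = mat 1"
    by (rule matrix_inv_eqI) simp
  have "- (x \<bullet> x) / 2 = (\<Sum>i\<in>UNIV. - (x $ i)\<^sup>2 / 2)"
    by (simp add: inner_vec_def power2_eq_square sum_negf sum_divide_distrib)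
  then have "gaussian_density 0 (mat 1) x = exp (\<Sum>i\<in>UNIV. - (x $ i)\<^sup>2 / 2) / sqrt (2 * pi) ^ CARD('n)"
    by (simp add: gaussian_density_def mat real_sqrt_power real_sqrt_mult power_mult_distrib)
  also have "\<dots> = (\<Prod>i\<in>UNIV. 1 / sqrt (2 * pi) * exp (- (x $ i)\<^sup>2 / 2))"
    by (simp add: exp_sum prod_dividef)
  finally show ?thesis unfolding std_normal_density_def .
qed

lemma standard_gaussian_density_measurable [measurable]:
  "(\<lambda>x. gaussian_density 0 (mat 1 :: real^'n^'n) x) \<in> borel_measurable borel"
  by (subst standard_gaussian_density_prod) measurable

lemma emeasure_standard_gaussian_prod:
  assumes A: "\<And>i. A i \<in> sets borel"
  shows "emeasure (density lborel (\<lambda>x. ennreal (gaussian_density 0 (mat 1) x))) {x :: real^'n. \<forall>i. x $ i \<in> A i}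
       = (\<Prod>i\<in>UNIV. emeasure std_normal (A i))"
proof -
  interpret product_sigma_finite "\<lambda>_::'n. lborel :: real measure" ..
  note [measurable] = A
  have "emeasure (density lborel (\<lambda>x. ennreal (gaussian_density 0 (mat 1) x))) {x :: real^'n. \<forall>i. x $ i \<in> A i}
      = (\<integral>\<^sup>+x. ennreal (gaussian_density 0 (mat 1) x) * indicator {x. \<forall>i. x $ i \<in> A i} x \<partial>lborel)"
    by (subst emeasure_density) auto
  also have "\<dots> = (\<integral>\<^sup>+x. (\<Prod>i\<in>UNIV. ennreal (std_normal_density (x i)) * indicator (A i) (x i)) \<partial>PiM UNIV (\<lambda>_. lborel))"
  proof (subst nn_integral_lborel_vec)
    show "(\<integral>\<^sup>+x. ennreal (gaussian_density 0 (mat 1) (vec_lambda x)) * indicator {x. \<forall>i. x $ i \<in> A i} (vec_lambda x) \<partial>PiM UNIV (\<lambda>_. lborel))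
       = (\<integral>\<^sup>+x. (\<Prod>i\<in>UNIV. ennreal (std_normal_density (x i)) * indicator (A i) (x i)) \<partial>PiM UNIV (\<lambda>_. lborel))"
    proof (rule nn_integral_cong)
      fix x :: "'n \<Rightarrow> real"
      have "indicator {x :: real^'n. \<forall>i. x $ i \<in> A i} (vec_lambda x) = (\<Prod>i\<in>UNIV. indicator (A i) (x i) :: ennreal)"
        by (auto simp: indicator_def prod_zero_iff)
      then show "ennreal (gaussian_density 0 (mat 1) (vec_lambda x)) * indicator {x. \<forall>i. x $ i \<in> A i} (vec_lambda x)
        = (\<Prod>i\<in>UNIV. ennreal (std_normal_density (x i)) * indicator (A i) (x i))"
        by (simp add: standard_gaussian_density_prod prod.distrib prod_ennreal)
    qed
  qed measurable
  also have "\<dots> = (\<Prod>i\<in>UNIV. (\<integral>\<^sup>+x. ennreal (std_normal_density x) * indicator (A i) x \<partial>lborel))"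
    by (rule product_nn_integral_prod) (use A in auto)
  also have "\<dots> = (\<Prod>i\<in>UNIV. emeasure std_normal (A i))"
    by (intro prod.cong refl emeasure_density[symmetric]) (use A in auto)
  finally show ?thesis .
qed

text \<open>
  Boxes generate the Borel sets and are stable under intersection, so it is enough to know the
  probabilities of products of one-dimensional sets.
\<close>

lemma distributed_standard_gaussianI:
  fixes X :: "'w \<Rightarrow> real^'n"
  assumes "prob_space M" and X[measurable]: "X \<in> borel_measurable M"
    and eq: "\<And>A. (\<And>i. A i \<in> sets borel) \<Longrightarrow>
      emeasure M {\<omega> \<in> space M. \<forall>i. X \<omega> $ i \<in> A i} = (\<Prod>i\<in>UNIV. emeasure std_normal (A i))"
  shows "distributed M lborel X (gaussian_density 0 (mat 1))"
proof -
  interpret prob_space M by fact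
  have "distr M borel X = density lborel (\<lambda>x. ennreal (gaussian_density 0 (mat 1) x))"
  proof (rule measure_eqI_generator_eq)
    let ?E = "range (\<lambda>(a, b). box a b :: (real^'n) set)"
    show "Int_stable ?E" by (auto simp: Int_stable_def box_Int_box)
    show "?E \<subseteq> Pow UNIV" "sets (distr M borel X) = sigma_sets UNIV ?E"
      "sets (density lborel (\<lambda>x. ennreal (gaussian_density 0 (mat 1) x))) = sigma_sets UNIV ?E"
      by (simp_all add: borel_eq_box)
    let ?A = "\<lambda>n::nat. box (- (real n *\<^sub>R One)) (real n *\<^sub>R One) :: (real^'n) set"
    show "range ?A \<subseteq> ?E" "(\<Union>i. ?A i) = UNIV"
      unfolding UN_box_eq_UNIV by auto
    interpret D: prob_space "distr M borel X" by (rule prob_space_distr) simp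
    show "emeasure (distr M borel X) (?A i) \<noteq> \<infinity>" for i by simp
    fix S assume "S \<in> ?E"
    then obtain a b where S: "S = box a b" by auto
    have S': "S = {x. \<forall>i. x $ i \<in> {a $ i <..< b $ i}}"
      by (auto simp: S mem_box_cart)
    have "emeasure (distr M borel X) S = emeasure M {\<omega> \<in> space M. \<forall>i. X \<omega> $ i \<in> {a $ i <..< b $ i}}"
      by (subst emeasure_distr) (auto simp: S mem_box_cart intro!: arg_cong[where f="emeasure M"])
    also have "\<dots> = (\<Prod>i\<in>UNIV. emeasure std_normal {a $ i <..< b $ i})"
      by (rule eq) simp
    also have "\<dots> = emeasure (density lborel (\<lambda>x. ennreal (gaussian_density 0 (mat 1) x))) S"
      unfolding S' by (rule emeasure_standard_gaussian_prod[symmetric]) simp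
    finally show "emeasure (distr M borel X) S
      = emeasure (density lborel (\<lambda>x. ennreal (gaussian_density 0 (mat 1) x))) S" .
  qed
  moreover have "distr M lborel X = distr M borel X" by (rule distr_cong) simp_all
  ultimately show ?thesis unfolding distributed_def by simp
qed

text \<open>
  Splitting each \<open>X j\<close> into its coordinates and enumerating all coordinates by \<open>\<pi>\<close> factorises the
  probability of a product set twice: over \<open>j\<close> by independence, and over the coordinates of each
  \<open>X j\<close> because the standard density is a product.
\<close>

lemma distributed_standard_gaussian_stack:
  fixes X :: "'j::finite \<Rightarrow> 'w \<Rightarrow> real^'m" and \<pi> :: "'p::finite \<Rightarrow> 'j \<times> 'm"
  assumes "prob_space M" and ind: "prob_space.indep_vars M (\<lambda>_. borel) X UNIV"
    and X: "\<And>j. distributed M lborel (X j) (gaussian_density 0 (mat 1))"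
    and \<pi>: "bij \<pi>"
  shows "distributed M lborel (\<lambda>\<omega>. \<chi> b. X (fst (\<pi> b)) \<omega> $ snd (\<pi> b)) (gaussian_density 0 (mat 1))"
proof (rule distributed_standard_gaussianI[OF assms(1)])
  interpret prob_space M by fact
  have Xm[measurable]: "X j \<in> borel_measurable M" for j
    using distributed_measurable[OF X] by simp
  show "(\<lambda>\<omega>. \<chi> b. X (fst (\<pi> b)) \<omega> $ snd (\<pi> b)) \<in> borel_measurable M"
    by (subst borel_measurable_euclidean_space) (auto simp: Basis_vec_def inner_axis)
  fix A :: "'p \<Rightarrow> real set" assume A: "\<And>i. A i \<in> sets borel"
  define S where "S j = {x :: real^'m. \<forall>i. x $ i \<in> A (inv \<pi> (j, i))}" for j
  have S[measurable]: "S j \<in> sets borel" for j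
  proof -
    note [measurable] = A
    have "{x \<in> space (borel :: (real^'m) measure). \<forall>i. x $ i \<in> A (inv \<pi> (j, i))} \<in> sets borel" by measurable
    then show ?thesis by (simp add: S_def)
  qed
  have \<pi>_inv: "\<pi> (inv \<pi> p) = p" for p using \<pi> by (simp add: bij_is_surj surj_f_inv_f)
  have inv_\<pi>: "inv \<pi> (\<pi> b) = b" for b using \<pi> by (simp add: bij_is_inj)
  have "{\<omega> \<in> space M. \<forall>i. (\<chi> b. X (fst (\<pi> b)) \<omega> $ snd (\<pi> b)) $ i \<in> A i}
      = (\<Inter>j\<in>UNIV. X j -` S j \<inter> space M)" (is "?L = ?R")
  proof (intro equalityI subsetI)
    fix \<omega> assume "\<omega> \<in> ?L"
    then have *: "\<omega> \<in> space M" "X (fst (\<pi> b)) \<omega> $ snd (\<pi> b) \<in> A b" for b by auto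
    have "X j \<omega> $ i \<in> A (inv \<pi> (j, i))" for j i
      using *(2)[of "inv \<pi> (j, i)"] by (simp add: \<pi>_inv)
    then show "\<omega> \<in> ?R" using *(1) by (auto simp: S_def)
  next
    fix \<omega> assume "\<omega> \<in> ?R"
    then have *: "\<omega> \<in> space M" "X j \<omega> $ i \<in> A (inv \<pi> (j, i))" for j i by (auto simp: S_def)
    have "X (fst (\<pi> b)) \<omega> $ snd (\<pi> b) \<in> A b" for b
      using *(2)[of "fst (\<pi> b)" "snd (\<pi> b)"] by (simp add: inv_\<pi>)
    then show "\<omega> \<in> ?L" using *(1) by simp
  qed
  then have "emeasure M {\<omega> \<in> space M. \<forall>i. (\<chi> b. X (fst (\<pi> b)) \<omega> $ snd (\<pi> b)) $ i \<in> A i}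
      = ennreal (prob (\<Inter>j\<in>UNIV. X j -` S j \<inter> space M))"
    by (simp add: emeasure_eq_measure)
  also have "\<dots> = ennreal (\<Prod>j\<in>UNIV. prob (X j -` S j \<inter> space M))"
    by (subst indep_varsD_finite[OF ind]) auto
  also have "\<dots> = (\<Prod>j\<in>UNIV. emeasure M (X j -` S j \<inter> space M))"
    by (simp add: emeasure_eq_measure prod_ennreal)
  also have "\<dots> = (\<Prod>j\<in>UNIV. \<Prod>i\<in>UNIV. emeasure std_normal (A (inv \<pi> (j, i))))"
  proof (rule prod.cong[OF refl])
    fix j
    have "emeasure M (X j -` S j \<inter> space M) = emeasure (distr M lborel (X j)) (S j)"
      by (subst emeasure_distr) auto
    also have "\<dots> = (\<Prod>i\<in>UNIV. emeasure std_normal (A (inv \<pi> (j, i))))"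
      unfolding distributed_distr_eq_density[OF X] S_def
      by (rule emeasure_standard_gaussian_prod) (rule A)
    finally show "emeasure M (X j -` S j \<inter> space M) = (\<Prod>i\<in>UNIV. emeasure std_normal (A (inv \<pi> (j, i))))" .
  qed
  also have "\<dots> = (\<Prod>p\<in>UNIV. emeasure std_normal (A (inv \<pi> p)))"
    by (simp add: prod.cartesian_product flip: UNIV_Times_UNIV)
  also have "\<dots> = (\<Prod>b\<in>UNIV. emeasure std_normal (A b))"
    by (rule prod.reindex_bij_betw) (use \<pi> in \<open>simp add: bij_imp_bij_inv\<close>)
  finally show "emeasure M {\<omega> \<in> space M. \<forall>i. (\<chi> b. X (fst (\<pi> b)) \<omega> $ snd (\<pi> b)) $ i \<in> A i}
    = (\<Prod>b\<in>UNIV. emeasure std_normal (A b))" .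
qed

text \<open>
  If the images of the maps \<open>T j\<close> are mutually \<open>P\<close>-orthogonal and \<open>T j\<close> pulls \<open>P\<close> back to \<open>Q j\<close>, then
  \<open>Q j\<close>-orthonormal bases of the blocks are mapped to a \<open>P\<close>-orthonormal family. The bijection \<open>\<pi>\<close>
  numbers its members by the coordinates of the large space, which makes them the columns of a
  square matrix \<open>L\<close>.
\<close>

lemma block_whitening:
  fixes T :: "'j::finite \<Rightarrow> real^'m \<Rightarrow> real^'p" and B Q :: "'j \<Rightarrow> real^'m^'m" and P :: "real^'p^'p"
    and \<pi> :: "'p \<Rightarrow> 'j \<times> 'm"
  assumes lin: "\<And>j. linear (T j)"
    and orth: "\<And>i j v w. T i v \<bullet> (P *v T j w) = (if i = j then v \<bullet> (Q i *v w) else 0)"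
    and B: "\<And>j. transpose (B j) ** Q j ** B j = mat 1" and \<pi>: "bij \<pi>"
  defines "L \<equiv> matrix_of_columns (\<lambda>b. T (fst (\<pi> b)) (B (fst (\<pi> b)) *v axis (snd (\<pi> b)) 1))"
  shows "transpose L ** P ** L = mat 1"
    and "L *v (\<chi> b. X (fst (\<pi> b)) $ snd (\<pi> b)) = (\<Sum>j\<in>UNIV. T j (B j *v X j))"
proof -
  have col: "column b L = T (fst (\<pi> b)) (B (fst (\<pi> b)) *v axis (snd (\<pi> b)) 1)" for b
    by (simp add: L_def matrix_of_columns_def column_def)
  show "transpose L ** P ** L = mat 1"
  proof (subst vec_eq_iff, intro allI, subst vec_eq_iff, intro allI)
    fix a b
    show "(transpose L ** P ** L) $ a $ b = (mat 1 :: real^'p^'p) $ a $ b"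
    proof (cases "fst (\<pi> a) = fst (\<pi> b)")
      case True
      have "(transpose L ** P ** L) $ a $ b
        = (transpose (B (fst (\<pi> b))) ** Q (fst (\<pi> b)) ** B (fst (\<pi> b))) $ snd (\<pi> a) $ snd (\<pi> b)"
        unfolding matrix_congruence_entry col orth by (simp add: True matrix_vector_mult_basis)
      also have "\<dots> = (mat 1 :: real^'p^'p) $ a $ b"
        unfolding B using True bij_is_inj[OF \<pi>] by (auto simp: mat_def inj_on_def prod_eq_iff)
      finally show ?thesis .
    next
      case False
      then show ?thesis
        unfolding matrix_congruence_entry col orth by (auto simp: mat_def)
    qed
  qed
  have "L *v (\<chi> b. X (fst (\<pi> b)) $ snd (\<pi> b))
      = (\<Sum>b\<in>UNIV. X (fst (\<pi> b)) $ snd (\<pi> b) *\<^sub>R column b L)"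
    by (simp add: matrix_mult_sum scalar_mult_eq_scaleR)
  also have "\<dots> = (\<Sum>p\<in>UNIV. X (fst p) $ snd p *\<^sub>R T (fst p) (B (fst p) *v axis (snd p) 1))"
    unfolding col by (rule sum.reindex_bij_betw[OF \<pi>])
  also have "\<dots> = (\<Sum>j\<in>UNIV. \<Sum>i\<in>UNIV. X j $ i *\<^sub>R T j (B j *v axis i 1))"
    by (simp add: sum.cartesian_product case_prod_beta flip: UNIV_Times_UNIV)
  also have "\<dots> = (\<Sum>j\<in>UNIV. T j (B j *v X j))"
  proof (rule sum.cong[OF refl])
    fix j
    have "T j (B j *v X j) = T j (B j *v (\<Sum>i\<in>UNIV. X j $ i *\<^sub>R axis i 1))"
      using basis_expansion[of "X j"] by (simp add: scalar_mult_eq_scaleR)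
    also have "\<dots> = (\<Sum>i\<in>UNIV. X j $ i *\<^sub>R T j (B j *v axis i 1))"
      by (simp add: linear_sum[OF lin] linear_cmul[OF lin] matrix_vector_mult_scaleR
        linear_sum[OF matrix_vector_mul_linear])
    finally show "(\<Sum>i\<in>UNIV. X j $ i *\<^sub>R T j (B j *v axis i 1)) = T j (B j *v X j)" ..
  qed
  finally show "L *v (\<chi> b. X (fst (\<pi> b)) $ snd (\<pi> b)) = (\<Sum>j\<in>UNIV. T j (B j *v X j))" .
qed

context
  fixes T :: "'j::finite \<Rightarrow> real^'m \<Rightarrow> real^'p" and Q :: "'j \<Rightarrow> real^'m^'m" and P :: "real^'p^'p"
  assumes card: "CARD('p) = CARD('j) * CARD('m)"
    and lin: "\<And>j. linear (T j)"
    and Q: "\<And>j. sym_pos_def (Q j)"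
    and orth: "\<And>i j v w. T i v \<bullet> (P *v T j w) = (if i = j then v \<bullet> (Q i *v w) else 0)"
begin

private lemma ex_whitening:
  "\<exists>(B :: 'j \<Rightarrow> real^'m^'m) (\<pi> :: 'p \<Rightarrow> 'j \<times> 'm). (\<forall>j. transpose (B j) ** Q j ** B j = mat 1) \<and> bij \<pi>"
proof -
  have "\<exists>B :: real^'m^'m. transpose B ** Q j ** B = mat 1" for j
    by (rule sym_pos_def_whitening[OF Q[of j]]) (erule exI)
  then obtain B :: "'j \<Rightarrow> real^'m^'m" where B: "\<And>j. transpose (B j) ** Q j ** B j = mat 1" by metis
  have "CARD('p) = CARD('j \<times> 'm)" using card by simp
  then obtain \<pi> :: "'p \<Rightarrow> 'j \<times> 'm" where "bij \<pi>"
    using finite_same_card_bij[OF finite_class.finite_UNIV finite_class.finite_UNIV] by metis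
  with B show ?thesis by blast
qed

text \<open>
  The count of dimensions makes the matrix \<open>L\<close> of \<open>block_whitening\<close> square, so its columns are a \<open>P\<close>-orthonormal basis and determine
  \<open>P\<close> on the whole space.
\<close>

lemma sym_pos_def_of_blocks: "sym_pos_def P"
proof -
  obtain B :: "'j \<Rightarrow> real^'m^'m" and \<pi> :: "'p \<Rightarrow> 'j \<times> 'm"
    where B: "\<And>j. transpose (B j) ** Q j ** B j = mat 1" and \<pi>: "bij \<pi>"
    using ex_whitening by blast
  show ?thesis
    by (rule sym_pos_def_of_whitening[OF block_whitening(1)[OF lin orth B \<pi>]])
qed

text \<open>
  Sampling in \<open>P\<close>-orthogonal blocks. Each \<open>X j\<close> is \<open>B j\<close> times a standard Gaussian vector; stacking
  these vectors gives one standard Gaussian vector \<open>Y\<close>, and the sum equals \<open>L Y\<close> for the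
  \<open>P\<close>-whitening matrix \<open>L\<close> of \<open>block_whitening\<close>.
\<close>

lemma distributed_gaussian_sum:
  fixes X :: "'j \<Rightarrow> 'w \<Rightarrow> real^'m"
  assumes "prob_space M" and ind: "prob_space.indep_vars M (\<lambda>_. borel) X UNIV"
    and X: "\<And>j. distributed M lborel (X j) (gaussian_density 0 (matrix_inv (Q j)))"
  shows "distributed M lborel (\<lambda>\<omega>. c + (\<Sum>j\<in>UNIV. T j (X j \<omega>))) (gaussian_density c (matrix_inv P))"
proof -
  obtain B :: "'j \<Rightarrow> real^'m^'m" and \<pi> :: "'p \<Rightarrow> 'j \<times> 'm"
    where B: "\<And>j. transpose (B j) ** Q j ** B j = mat 1" and \<pi>: "bij \<pi>"
    using ex_whitening by blast
  define Y where "Y j \<omega> = matrix_inv (B j) *v X j \<omega>" for j \<omega>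
  have BY: "B j *v Y j \<omega> = X j \<omega>" for j \<omega>
    by (simp add: Y_def matrix_inv_vector_right whitening_invertible[OF B])
  have Y: "distributed M lborel (Y j) (gaussian_density 0 (mat 1))" for j
    unfolding Y_def by (rule distributed_standard_of_gaussian[OF B X])
  have indY: "prob_space.indep_vars M (\<lambda>_. borel) Y UNIV"
    unfolding Y_def[abs_def] by (rule prob_space.indep_vars_compose2[OF assms(1) ind]) simp
  let ?Y = "\<lambda>\<omega>. \<chi> b. Y (fst (\<pi> b)) \<omega> $ snd (\<pi> b)"
  define L where "L = matrix_of_columns (\<lambda>b. T (fst (\<pi> b)) (B (fst (\<pi> b)) *v axis (snd (\<pi> b)) 1))"
  have L: "transpose L ** P ** L = mat 1"
    unfolding L_def by (rule block_whitening(1)[OF lin orth B \<pi>])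
  have LY: "L *v ?Y \<omega> = (\<Sum>j\<in>UNIV. T j (X j \<omega>))" for \<omega>
    unfolding L_def
    using block_whitening(2)[OF lin orth B \<pi>, of "\<lambda>j. Y j \<omega>"] by (simp only: BY)
  have "distributed M lborel ?Y (gaussian_density 0 (mat 1))"
    by (rule distributed_standard_gaussian_stack[OF assms(1) indY Y \<pi>])
  from distributed_gaussian_of_standard[OF L this, of c] show ?thesis
    unfolding LY .
qed

end

section \<open>Tensor structure of the parameter space\<close>

text \<open>
  The parameter vector \<open>u \<otimes> (s, y)\<close> when \<open>real^('m + 'm \<times> 'n)\<close> is read as the tensor product of
  \<open>real^'m\<close> with \<open>real \<times> real^'n\<close>. The posterior mean and the samples are
  sums of such vectors.
\<close>

definition tensor :: "real^'m \<Rightarrow> real \<times> (real^'n) \<Rightarrow> real^('m + 'm \<times> 'n)" where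
  "tensor u x = block_vec (fst x *\<^sub>R u) (kron_vec u (snd x))"

lemma sum_plus_UNIV:
  fixes f :: "'a::finite + 'b::finite \<Rightarrow> 'c::comm_monoid_add"
  shows "(\<Sum>i\<in>UNIV. f i) = (\<Sum>i\<in>UNIV. f (Inl i)) + (\<Sum>j\<in>UNIV. f (Inr j))"
  using sum.Plus[of "UNIV :: 'a set" "UNIV :: 'b set" f] by simp

lemma sum_prod_UNIV:
  fixes f :: "'a::finite \<times> 'b::finite \<Rightarrow> 'c::comm_monoid_add"
  shows "(\<Sum>i\<in>UNIV. f i) = (\<Sum>i\<in>UNIV. \<Sum>j\<in>UNIV. f (i, j))"
  by (simp add: sum.cartesian_product flip: UNIV_Times_UNIV)

lemma tensor_add_left: "tensor (u + v) x = tensor u x + tensor v x"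
  by (auto simp: tensor_def block_vec_def kron_vec_def vec_eq_iff algebra_simps split: sum.split)

lemma tensor_scaleR_left: "tensor (c *\<^sub>R u) x = c *\<^sub>R tensor u x"
  by (auto simp: tensor_def block_vec_def kron_vec_def vec_eq_iff algebra_simps split: sum.split)

lemma tensor_add_right: "tensor u (x + y) = tensor u x + tensor u y"
  by (auto simp: tensor_def block_vec_def kron_vec_def vec_eq_iff algebra_simps split: sum.split)

lemma tensor_scaleR_right: "tensor u (c *\<^sub>R x) = c *\<^sub>R tensor u x"
  by (auto simp: tensor_def block_vec_def kron_vec_def vec_eq_iff algebra_simps split: sum.split)

lemma linear_tensor_left: "linear (\<lambda>u. tensor u x)"
  by (rule linearI) (simp_all add: tensor_add_left tensor_scaleR_left)

lemma linear_tensor_right: "linear (tensor u)"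
  by (rule linearI) (simp_all add: tensor_add_right tensor_scaleR_right)

lemma inner_tensor: "tensor u x \<bullet> tensor v y = (u \<bullet> v) * (x \<bullet> y)"
proof -
  have "tensor u x \<bullet> tensor v y
     = (\<Sum>i\<in>UNIV. fst x * u $ i * (fst y * v $ i)) + (\<Sum>i\<in>UNIV. \<Sum>j\<in>UNIV. u $ i * snd x $ j * (v $ i * snd y $ j))"
    by (simp add: inner_vec_def sum_plus_UNIV sum_prod_UNIV tensor_def block_vec_def kron_vec_def)
  also have "(\<Sum>i\<in>UNIV. fst x * u $ i * (fst y * v $ i)) = (u \<bullet> v) * (fst x * fst y)"
    by (simp add: inner_vec_def sum_distrib_left mult_ac)
  also have "(\<Sum>i\<in>UNIV. \<Sum>j\<in>UNIV. u $ i * snd x $ j * (v $ i * snd y $ j)) = (u \<bullet> v) * (snd x \<bullet> snd y)"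
    by (simp add: inner_vec_def sum_product algebra_simps)
  finally show ?thesis
    by (cases x, cases y) (simp add: algebra_simps)
qed

text \<open>
  The second factor \<open>K\<close> of the prior precision: \<open>W\<^sub>\<theta> = W\<^sub>u \<otimes> K\<close>. The number \<open>r\<close> is the value at
  \<open>z\<^sub>t\<close> of the affine function \<open>z \<mapsto> s + z \<bullet> M\<^sub>z y\<close> with coefficients \<open>x = (s, y)\<close>.
\<close>

definition coefficient_precision ::
    "real^'n^'n \<Rightarrow> real^'n^'n \<Rightarrow> real^'n \<Rightarrow> real \<times> (real^'n) \<Rightarrow> real \<times> (real^'n)" where
  "coefficient_precision Wz Mz zt x =
     (let r = fst x + zt \<bullet> (Mz *v snd x)
      in (r, r *\<^sub>R (Mz *v zt) + Mz *v (Wz *v (Mz *v snd x))))"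

lemma outer_vector_mult: "outer v w *v x = (w \<bullet> x) *\<^sub>R v"
  by (auto simp: outer_def matrix_vector_mult_def inner_vec_def vec_eq_iff sum_distrib_left sum_distrib_right
      mult_ac intro!: sum.cong)

lemma block_matrix_mult_block_vec:
  "block_matrix A B C D *v block_vec u v = block_vec (A *v u + B *v v) (C *v u + D *v v)"
  by (auto simp: block_matrix_def block_vec_def matrix_vector_mult_def vec_eq_iff sum_plus_UNIV split: sum.split)

lemma block_row_mult_block_vec: "block_row A B *v block_vec u v = A *v u + B *v v"
  by (auto simp: block_row_def block_vec_def matrix_vector_mult_def vec_eq_iff sum_plus_UNIV split: sum.split)

lemma kron_mult_kron_vec: "kron A B *v kron_vec u v = kron_vec (A *v u) (B *v v)"
  by (auto simp: kron_def kron_vec_def matrix_vector_mult_def vec_eq_iff sum_prod_UNIV sum_product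
      intro!: sum.cong)

lemma kron_row_mult_kron_vec: "kron_row A w *v kron_vec u v = (w \<bullet> v) *\<^sub>R (A *v u)"
  by (auto simp: kron_row_def kron_vec_def matrix_vector_mult_def vec_eq_iff sum_prod_UNIV sum_product
      inner_vec_def mult_ac) (subst sum.swap, simp add: sum_distrib_left)

lemma kron_col_mult_vec: "kron_col A w *v u = kron_vec (A *v u) w"
  by (auto simp: kron_col_def kron_vec_def matrix_vector_mult_def vec_eq_iff sum_distrib_left
      mult_ac intro!: sum.cong)

lemma prior_precision_tensor:
  assumes "transpose Mz = Mz"
  shows "prior_precision Wu Wz Mz zt *v tensor u x
    = tensor (Wu *v u) (coefficient_precision Wz Mz zt x)"
proof -
  have M: "zt v* Mz = Mz *v zt" using assms by (metis transpose_matrix_vector)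
  have i: "(Mz *v zt) \<bullet> v = zt \<bullet> (Mz *v v)" for v
    by (simp add: inner_matrix_transpose assms)
  show ?thesis
    unfolding prior_precision_def tensor_def block_matrix_mult_block_vec
      kron_mult_kron_vec kron_row_mult_kron_vec kron_col_mult_vec M i coefficient_precision_def Let_def
    by (auto simp: vec_eq_iff block_vec_def kron_vec_def outer_vector_mult matrix_vector_mult_add_rdistrib
       matrix_vector_right_distrib matrix_vector_mult_scaleR
       algebra_simps simp flip: matrix_vector_mul_assoc split: sum.split)
qed

lemma discrepancy_tensor:
  assumes "transpose Mz = Mz"
  shows "discrepancy_matrix Mz z *v tensor u x = ((1, Mz *v z) \<bullet> x) *\<^sub>R u"
proof -
  have M: "z v* Mz = Mz *v z" using assms by (metis transpose_matrix_vector)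
  show ?thesis
    unfolding discrepancy_matrix_def tensor_def block_row_mult_block_vec kron_row_mult_kron_vec M
    by (cases x) (simp add: algebra_simps)
qed

lemma transpose_discrepancy:
  assumes "transpose Mz = Mz"
  shows "transpose (discrepancy_matrix Mz z) *v u = tensor u (1, Mz *v z)"
proof -
  have M: "z v* Mz = Mz *v z" using assms by (metis transpose_matrix_vector)
  show ?thesis
    unfolding M discrepancy_matrix_def
    by (auto simp: vec_eq_iff tensor_def block_row_def block_vec_def kron_row_def kron_vec_def mat_def
       matrix_vector_mult_def transpose_def if_distrib if_distribR cong: if_cong split: sum.split)
qed

lemma transpose_stack_rows_kron_stack_vec:
  "(transpose (stack_rows A) ** kron (mat 1) M) *v stack_vec d = (\<Sum>l\<in>UNIV. transpose (A l) *v (M *v d l))"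
proof -
  have "kron (mat 1) M *v stack_vec d = stack_vec (\<lambda>l. M *v d l)"
    by (auto simp: vec_eq_iff kron_def mat_def stack_vec_def matrix_vector_mult_def sum_prod_UNIV
       if_distrib if_distribR sum.If_cases cong: if_cong) 
  moreover have "transpose (stack_rows A) *v stack_vec e = (\<Sum>l\<in>UNIV. transpose (A l) *v e l)" for e
    by (auto simp: vec_eq_iff stack_rows_def stack_vec_def matrix_vector_mult_def transpose_def sum_prod_UNIV)
  ultimately show ?thesis by (simp flip: matrix_vector_mul_assoc)
qed

lemma stack_rows_mult_vec: "stack_rows A *v x = stack_vec (\<lambda>l. A l *v x)"
  by (auto simp: vec_eq_iff stack_rows_def stack_vec_def matrix_vector_mult_def)

section \<open>Posterior precision and normal equations\<close>

text \<open>
  The prior penalises separately the value at \<open>z\<^sub>t\<close> and the gradient of the affine function with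
  coefficients \<open>x\<close>. Symmetry and positivity of \<open>K\<close> can be read off from this form.
\<close>

lemma coefficient_precision_inner:
  assumes "transpose Mz = Mz"
  shows "coefficient_precision Wz Mz zt x \<bullet> x'
    = (fst x + zt \<bullet> (Mz *v snd x)) * (fst x' + zt \<bullet> (Mz *v snd x'))
      + (Wz *v (Mz *v snd x)) \<bullet> (Mz *v snd x')"
proof -
  have i: "(Mz *v v) \<bullet> w = v \<bullet> (Mz *v w)" for v w
    by (simp add: inner_matrix_transpose assms)
  show ?thesis
    by (cases x, cases x')
       (simp add: coefficient_precision_def Let_def i inner_add_left algebra_simps)
qed

lemma coefficient_precision_linear: "linear (coefficient_precision Wz Mz zt)"
  by (rule linearI)
     (simp_all add: coefficient_precision_def Let_def matrix_vector_right_distrib matrix_vector_mult_scaleR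
       inner_add_right algebra_simps)

lemma transpose_gram_mult_vec:
  "(transpose (stack_rows A) ** kron (mat 1) M ** stack_rows A) *v t
    = (\<Sum>l\<in>UNIV. transpose (A l) *v (M *v (A l *v t)))"
  using transpose_stack_rows_kron_stack_vec[of A M "\<lambda>l. A l *v t"]
  by (simp add: stack_rows_mult_vec flip: matrix_vector_mul_assoc)

lemma independent_range_sum_eq_0:
  fixes z :: "'N::finite \<Rightarrow> 'v::real_vector"
  assumes "inj z" "independent (range z)" "(\<Sum>l\<in>UNIV. c l *\<^sub>R z l) = 0"
  shows "c l = 0"
proof -
  have "(\<Sum>v\<in>range z. c (inv z v) *\<^sub>R v) = 0"
    using assms(1,3) by (simp add: sum.reindex)
  from independentD[OF assms(2) _ subset_refl this, of "z l"] show ?thesis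
    using assms(1) by simp
qed

text \<open>
  The deterministic data of the inverse problem. In this setting, \<open>observation l\<close> is the vector \<open>h\<^sub>l\<close>
  such that \<open>h\<^sub>l \<bullet> x\<close> is the value at \<open>z l\<close> of the affine function with coefficients \<open>x\<close>, and \<open>lift l\<close> is its
  representer \<open>K\<^sup>-\<^sup>1 h\<^sub>l\<close>.
\<close>

locale linear_discrepancy =
  fixes Mu Wu :: "real^'m^'m" and Mz Wz :: "real^'n^'n" and \<alpha> :: real and zt :: "real^'n"
    and z :: "'N::finite \<Rightarrow> real^'n"
  assumes Mu: "sym_pos_def Mu" and Mz: "sym_pos_def Mz" and Wu: "sym_pos_def Wu" and Wz: "sym_pos_def Wz"
    and \<alpha>: "\<alpha> > 0" and inj_z: "inj z" and independent_z: "independent (range z)"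
begin

definition observation :: "'N \<Rightarrow> real \<times> (real^'n)" where
  "observation l = (1, Mz *v z l)"

definition lift :: "'N \<Rightarrow> real \<times> (real^'n)" where
  "lift l = (1 - zt \<bullet> (matrix_inv Wz *v (z l - zt)), matrix_inv Mz *v (matrix_inv Wz *v (z l - zt)))"

abbreviation K :: "real \<times> (real^'n) \<Rightarrow> real \<times> (real^'n)" where
  "K \<equiv> coefficient_precision Wz Mz zt"

definition posterior_precision :: "real^('m + 'm \<times> 'n)^('m + 'm \<times> 'n)" where
  "posterior_precision = prior_precision Wu Wz Mz zt
     + (1 / \<alpha>) *\<^sub>R (transpose (stack_rows (\<lambda>l. discrepancy_matrix Mz (z l))) ** kron (mat 1) Mu
         ** stack_rows (\<lambda>l. discrepancy_matrix Mz (z l)))"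

lemmas Mz_symmetric = sym_pos_def_symmetric[OF Mz]
lemmas Mz_invertible = sym_pos_def_invertible[OF Mz]
lemmas Wz_invertible = sym_pos_def_invertible[OF Wz]

lemma posterior_precision_mult_vec:
  "posterior_precision *v t = prior_precision Wu Wz Mz zt *v t
     + (\<Sum>l\<in>UNIV. transpose (discrepancy_matrix Mz (z l)) *v (((1 / \<alpha>) *\<^sub>R Mu) *v (discrepancy_matrix Mz (z l) *v t)))"
  by (simp add: posterior_precision_def matrix_vector_mult_add_rdistrib transpose_gram_mult_vec
      scaleR_sum_right matrix_vector_mult_scaleR flip: scaleR_matrix_vector_assoc)

text \<open>
  In tensor form the posterior precision is \<open>W\<^sub>u \<otimes> K + \<alpha>\<^sup>-\<^sup>1 M\<^sub>u \<otimes> H\<close> with \<open>H = \<Sum>\<^sub>l h\<^sub>l h\<^sub>l\<^sup>T\<close>.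
\<close>

lemma posterior_precision_tensor:
  "posterior_precision *v tensor u x
    = tensor (Wu *v u) (K x) + (1 / \<alpha>) *\<^sub>R tensor (Mu *v u) (\<Sum>l\<in>UNIV. (observation l \<bullet> x) *\<^sub>R observation l)"
  unfolding posterior_precision_mult_vec prior_precision_tensor[OF Mz_symmetric] discrepancy_tensor[OF Mz_symmetric]
    transpose_discrepancy[OF Mz_symmetric] observation_def[symmetric]
  by (simp add: linear_sum[OF linear_tensor_right] tensor_scaleR_right tensor_scaleR_left
      matrix_vector_mult_scaleR scaleR_sum_right mult.commute flip: scaleR_matrix_vector_assoc)

lemma K_lift: "K (lift l) = observation l"
proof -
  have "Mz *v snd (lift l) = matrix_inv Wz *v (z l - zt)"
    by (simp add: lift_def matrix_inv_vector_right Mz_invertible)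
  then show ?thesis
    by (simp add: coefficient_precision_def lift_def observation_def matrix_inv_vector_right Mz_invertible
        Wz_invertible matrix_vector_mult_diff_distrib)
qed

text \<open>
  The right-hand side is the entry \<open>(j, l)\<close> of the matrix \<open>G\<close>, which is therefore the Gram matrix
  \<open>h\<^sub>j \<bullet> K\<^sup>-\<^sup>1 h\<^sub>l\<close> of the observations.
\<close>

lemma observation_inner_lift:
  "observation j \<bullet> lift l = 1 + (z j - zt) \<bullet> (matrix_inv Wz *v (z l - zt))"
proof -
  have "(Mz *v z j) \<bullet> (matrix_inv Mz *v v) = z j \<bullet> v" for v
    by (simp add: matrix_inv_vector_right Mz_invertible flip: sym_pos_def_inner_commute[OF Mz])
  then show ?thesis
    by (simp add: observation_def lift_def inner_diff_left)
qed

lemma observation_inner_lift_commute: "observation j \<bullet> lift l = observation l \<bullet> lift j"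
  unfolding observation_inner_lift sym_pos_def_inner_commute[OF sym_pos_def_matrix_inv[OF Wz], of "z j - zt"]
  by (simp add: inner_commute)

lemma K_inner_commute: "K x \<bullet> x' = x \<bullet> K x'"
proof -
  have "(Wz *v v) \<bullet> w = (Wz *v w) \<bullet> v" for v w
    by (subst inner_commute) (rule sym_pos_def_inner_commute[OF Wz])
  then show ?thesis
    by (subst inner_commute[of x]) (simp only: coefficient_precision_inner[OF Mz_symmetric] mult.commute)
qed

lemma K_pos:
  assumes "x \<noteq> 0"
  shows "K x \<bullet> x > 0"
proof (cases "snd x = 0")
  case True
  then have "fst x \<noteq> 0" using assms by (cases x) (auto simp: zero_prod_def)
  then show ?thesis using True by (simp add: coefficient_precision_inner[OF Mz_symmetric] flip: power2_eq_square)
next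
  case False
  then have "Mz *v snd x \<noteq> 0"
    using matrix_inv_vector_left[OF Mz_invertible, of "snd x"] by fastforce
  from sym_pos_def_pos[OF Wz this] show ?thesis
    by (simp only: coefficient_precision_inner[OF Mz_symmetric] inner_commute[of "Wz *v _"])
       (intro add_nonneg_pos zero_le_square)
qed

end

text \<open>
  An orthonormal eigenbasis \<open>g\<close> of the Gram matrix \<open>G\<close>. It yields the vectors
  \<open>direction i = \<Sum>\<^sub>j g\<^sub>i\<^sub>j K\<^sup>-\<^sup>1 h\<^sub>j\<close> in coefficient space, on which \<open>H\<close> acts as \<open>\<mu>\<^sub>i K\<close>.
\<close>

locale linear_discrepancy_eigen = linear_discrepancy Mu Wu Mz Wz \<alpha> zt z
  for Mu Wu :: "real^'m^'m" and Mz Wz :: "real^'n^'n" and \<alpha> :: real and zt :: "real^'n"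
    and z :: "'N::finite \<Rightarrow> real^'n" +
  fixes g :: "'N \<Rightarrow> real^'N" and \<mu> :: "'N \<Rightarrow> real"
  assumes eigen: "\<And>i l. (\<Sum>j\<in>UNIV. (observation l \<bullet> lift j) * g i $ j) = \<mu> i * g i $ l"
    and orthonormal: "\<And>i j. g i \<bullet> g j = (if i = j then 1 else 0)"
begin

definition direction :: "'N \<Rightarrow> real \<times> (real^'n)" where
  "direction i = (\<Sum>j\<in>UNIV. g i $ j *\<^sub>R lift j)"

lemma observation_inner_direction: "observation l \<bullet> direction i = \<mu> i * g i $ l"
  using eigen[of l i] by (simp add: direction_def inner_sum_right mult.commute)

lemma K_direction: "K (direction i) = (\<Sum>j\<in>UNIV. g i $ j *\<^sub>R observation j)"
  by (simp add: direction_def linear_sum[OF coefficient_precision_linear]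
      linear_cmul[OF coefficient_precision_linear] K_lift)

lemma K_direction_inner: "K (direction i) \<bullet> direction j = (if i = j then \<mu> i else 0)"
proof -
  have "K (direction i) \<bullet> direction j = \<mu> j * (g i \<bullet> g j)"
    by (simp add: K_direction inner_sum_left observation_inner_direction inner_vec_def sum_distrib_left mult_ac)
  then show ?thesis by (simp add: orthonormal)
qed

text \<open>
  Since \<open>\<mu>\<^sub>i = K x \<bullet> x\<close> for \<open>x = direction i\<close> and \<open>K\<close> is positive definite, only \<open>x = 0\<close> has to be
  excluded. It would give \<open>\<Sum>\<^sub>j g\<^sub>i\<^sub>j h\<^sub>j = 0\<close>, hence \<open>\<Sum>\<^sub>j g\<^sub>i\<^sub>j z\<^sub>j = 0\<close>, contradicting the linear
  independence of the \<open>z\<^sub>j\<close>.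
\<close>

lemma eigenvalue_pos: "\<mu> i > 0"
proof -
  have "direction i \<noteq> 0"
  proof
    assume "direction i = 0"
    then have "K (direction i) = 0"
      by (simp only: linear_0[OF coefficient_precision_linear])
    then have "snd (\<Sum>j\<in>UNIV. g i $ j *\<^sub>R observation j) = 0"
      unfolding K_direction by simp
    then have "Mz *v (\<Sum>j\<in>UNIV. g i $ j *\<^sub>R z j) = 0"
      by (simp add: snd_sum observation_def linear_sum[OF matrix_vector_mul_linear] matrix_vector_mult_scaleR)
    then have "(\<Sum>j\<in>UNIV. g i $ j *\<^sub>R z j) = 0"
      using matrix_inv_vector_left[OF Mz_invertible] by (metis matrix_vector_mult_0_right)
    then have "g i $ l = 0" for l
      by (rule independent_range_sum_eq_0[OF inj_z independent_z])
    then have "g i = 0" by (simp add: vec_eq_iff)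
    then show False using orthonormal[of i i] by simp
  qed
  from K_pos[OF this] show ?thesis by (simp add: K_direction_inner)
qed

text \<open>
  Because \<open>H x = \<mu>\<^sub>i K x\<close> for \<open>x = direction i\<close>, both Kronecker terms have the same second factor, and
  the precision acts on \<open>u\<close> alone.
\<close>

lemma posterior_precision_direction:
  "posterior_precision *v tensor u (direction i) = (1 / \<alpha>) *\<^sub>R tensor ((\<alpha> *\<^sub>R Wu + \<mu> i *\<^sub>R Mu) *v u) (K (direction i))"
proof -
  have "(\<Sum>l\<in>UNIV. (observation l \<bullet> direction i) *\<^sub>R observation l) = \<mu> i *\<^sub>R K (direction i)"
    by (simp add: observation_inner_direction K_direction scaleR_sum_right)
  then show ?thesis
    unfolding posterior_precision_tensor using \<alpha>
    by (simp add: tensor_scaleR_right tensor_scaleR_left tensor_add_left matrix_vector_mult_add_rdistrib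
        algebra_simps flip: scaleR_matrix_vector_assoc)
qed

lemma eigenvectors_complete: "(\<Sum>i\<in>UNIV. g i $ l * g i $ j) = (if l = j then 1 else 0)"
proof -
  define U :: "real^'N^'N" where "U = (\<chi> i. g i)"
  have "U ** transpose U = mat 1"
    using orthonormal
    by (simp add: U_def matrix_matrix_mult_def transpose_def mat_def vec_eq_iff inner_vec_def)
  then have "transpose U ** U = mat 1"
    by (simp add: matrix_left_right_inverse)
  then have "(transpose U ** U) $ l $ j = (if l = j then 1 else 0)"
    by (simp add: mat_def)
  then show ?thesis by (simp add: U_def matrix_matrix_mult_def transpose_def)
qed

text \<open>
  Completeness of the eigenbasis: the \<open>l\<close>-th column of \<open>G\<close> is \<open>\<Sum>\<^sub>i \<mu>\<^sub>i g\<^sub>i\<^sub>l g\<^sub>i\<close>, and the right-hand side is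
  \<open>H (lift l)\<close>.
\<close>

lemma eigen_expansion:
  "(\<Sum>i\<in>UNIV. (\<mu> i * g i $ l) *\<^sub>R K (direction i)) = (\<Sum>j\<in>UNIV. (observation j \<bullet> lift l) *\<^sub>R observation j)"
proof -
  have "(\<Sum>i\<in>UNIV. (\<mu> i * g i $ l) * g i $ j) = observation j \<bullet> lift l" for j
  proof -
    have "(\<Sum>i\<in>UNIV. (\<mu> i * g i $ l) * g i $ j)
        = (\<Sum>i\<in>UNIV. \<Sum>k\<in>UNIV. (observation l \<bullet> lift k) * (g i $ k * g i $ j))"
      by (simp only: eigen[symmetric] sum_distrib_right mult.assoc)
    also have "\<dots> = (\<Sum>k\<in>UNIV. (observation l \<bullet> lift k) * (if k = j then 1 else 0))"
      by (subst sum.swap, unfold sum_distrib_left[symmetric] eigenvectors_complete) (rule refl)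
    also have "\<dots> = observation j \<bullet> lift l"
      by (simp add: mult_delta_right observation_inner_lift_commute[of l j])
    finally show ?thesis .
  qed
  then have "(\<Sum>j\<in>UNIV. (observation j \<bullet> lift l) *\<^sub>R observation j)
      = (\<Sum>j\<in>UNIV. \<Sum>i\<in>UNIV. ((\<mu> i * g i $ l) * g i $ j) *\<^sub>R observation j)"
    by (simp flip: scaleR_sum_left)
  also have "\<dots> = (\<Sum>i\<in>UNIV. (\<mu> i * g i $ l) *\<^sub>R K (direction i))"
    by (subst sum.swap) (simp add: K_direction scaleR_sum_right)
  finally show ?thesis ..
qed

text \<open>
  The normal equations. The prior part of the precision maps \<open>u\<^sub>l \<otimes> lift l\<close> to the wanted term
  \<open>M\<^sub>u d\<^sub>l \<otimes> h\<^sub>l\<close>; the data part contributes in addition \<open>\<alpha>\<^sup>-\<^sup>1 M\<^sub>u u\<^sub>l \<otimes> H (lift l)\<close>, which the sum over the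
  eigendirections cancels.
\<close>

lemma posterior_precision_mean:
  fixes d u :: "'N \<Rightarrow> real^'m" and ui :: "'N \<Rightarrow> 'N \<Rightarrow> real^'m"
  assumes u: "\<And>l. Wu *v u l = Mu *v d l"
    and ui: "\<And>i l. (\<alpha> *\<^sub>R Wu + \<mu> i *\<^sub>R Mu) *v ui i l = Mu *v u l"
  shows "posterior_precision *v (\<Sum>l\<in>UNIV. tensor (u l) (lift l)
           - (\<Sum>i\<in>UNIV. (\<mu> i * g i $ l) *\<^sub>R tensor (ui i l) (direction i)))
       = (\<Sum>l\<in>UNIV. tensor (Mu *v d l) (observation l))"
proof -
  have "posterior_precision *v (tensor (u l) (lift l)
      - (\<Sum>i\<in>UNIV. (\<mu> i * g i $ l) *\<^sub>R tensor (ui i l) (direction i)))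
      = tensor (Mu *v d l) (observation l)" for l
  proof -
    have "posterior_precision *v (\<Sum>i\<in>UNIV. (\<mu> i * g i $ l) *\<^sub>R tensor (ui i l) (direction i))
        = (1 / \<alpha>) *\<^sub>R tensor (Mu *v u l) (\<Sum>i\<in>UNIV. (\<mu> i * g i $ l) *\<^sub>R K (direction i))"
      by (simp add: linear_sum[OF matrix_vector_mul_linear] matrix_vector_mult_scaleR
          posterior_precision_direction ui linear_sum[OF linear_tensor_right] tensor_scaleR_right
          scaleR_sum_right mult.commute)
    then show ?thesis
      by (simp add: matrix_vector_mult_diff_distrib posterior_precision_tensor K_lift u eigen_expansion)
  qed
  then show ?thesis
    by (simp add: linear_sum[OF matrix_vector_mul_linear])
qed

end

section \<open>Posterior samples and the posterior density\<close>

lemma gaussian_density_exp: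
  fixes Q :: "real^'n^'n"
  assumes Q: "sym_pos_def Q"
  obtains C where "C > 0" "\<And>c x. gaussian_density c (matrix_inv Q) x = C * exp (- ((x - c) \<bullet> (Q *v (x - c))) / 2)"
proof
  have det: "det (matrix_inv Q) > 0"
    by (rule sym_pos_def_det_pos[OF sym_pos_def_matrix_inv[OF Q]])
  show "1 / sqrt ((2 * pi) ^ CARD('n) * det (matrix_inv Q)) > 0"
    using det by simp
  show "gaussian_density c (matrix_inv Q) x
      = 1 / sqrt ((2 * pi) ^ CARD('n) * det (matrix_inv Q)) * exp (- ((x - c) \<bullet> (Q *v (x - c))) / 2)" for c x
    by (simp add: gaussian_density_def matrix_inv_matrix_inv[OF sym_pos_def_invertible[OF Q]])
qed

text \<open>
  Completing the square: the exponents on both sides are quadratic in \<open>t\<close> with the same Hessian \<open>P\<close> and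
  the same stationary point \<open>m\<close>, so they differ by the constant \<open>k\<close>.
\<close>

lemma gaussian_prior_times_likelihood:
  fixes W P :: "real^'p^'p" and Q :: "real^'m^'m" and A :: "'N::finite \<Rightarrow> real^'p^'m" and d :: "'N \<Rightarrow> real^'m"
  assumes W: "sym_pos_def W" and Q: "sym_pos_def Q" and P: "sym_pos_def P"
    and P_eq: "\<And>t. P *v t = W *v t + (\<Sum>l\<in>UNIV. transpose (A l) *v (Q *v (A l *v t)))"
    and m: "P *v m = (\<Sum>l\<in>UNIV. transpose (A l) *v (Q *v d l))"
  obtains C where "C > 0"
    "\<And>t. gaussian_density 0 (matrix_inv W) t * (\<Prod>l\<in>UNIV. gaussian_density (A l *v t) (matrix_inv Q) (d l))
        = C * gaussian_density m (matrix_inv P) t"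
proof -
  obtain CW where CW: "CW > 0" "\<And>c x. gaussian_density c (matrix_inv W) x = CW * exp (- ((x - c) \<bullet> (W *v (x - c))) / 2)"
    by (rule gaussian_density_exp[OF W]) blast
  obtain CQ where CQ: "CQ > 0" "\<And>c x. gaussian_density c (matrix_inv Q) x = CQ * exp (- ((x - c) \<bullet> (Q *v (x - c))) / 2)"
    by (rule gaussian_density_exp[OF Q]) blast
  obtain CP where CP: "CP > 0" "\<And>c x. gaussian_density c (matrix_inv P) x = CP * exp (- ((x - c) \<bullet> (P *v (x - c))) / 2)"
    by (rule gaussian_density_exp[OF P]) blast
  define k where "k = (\<Sum>l\<in>UNIV. d l \<bullet> (Q *v d l)) - m \<bullet> (P *v m)"
  have quad: "t \<bullet> (W *v t) + (\<Sum>l\<in>UNIV. (d l - A l *v t) \<bullet> (Q *v (d l - A l *v t)))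
      = (t - m) \<bullet> (P *v (t - m)) + k" for t
  proof -
    have expand: "(d l - A l *v t) \<bullet> (Q *v (d l - A l *v t))
        = d l \<bullet> (Q *v d l) - 2 * (t \<bullet> (transpose (A l) *v (Q *v d l))) + t \<bullet> (transpose (A l) *v (Q *v (A l *v t)))" for l
    proof -
      have "d l \<bullet> (Q *v (A l *v t)) = (A l *v t) \<bullet> (Q *v d l)"
        using sym_pos_def_inner_commute[OF Q, of "d l" "A l *v t"] by (simp add: inner_commute)
      moreover have "t \<bullet> (transpose (A l) *v v) = (A l *v t) \<bullet> v" for v
        by (simp only: inner_matrix_transpose transpose_transpose)
      ultimately show ?thesis
        by (simp only: matrix_vector_mult_diff_distrib inner_diff_left inner_diff_right)
    qed
    have "t \<bullet> (W *v t) + (\<Sum>l\<in>UNIV. (d l - A l *v t) \<bullet> (Q *v (d l - A l *v t)))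
      = t \<bullet> (P *v t) - 2 * (t \<bullet> (P *v m)) + (\<Sum>l\<in>UNIV. d l \<bullet> (Q *v d l))"
      unfolding expand P_eq[of t] m by (simp add: sum.distrib sum_subtractf inner_add_right inner_sum_right sum_distrib_left)
    moreover have "m \<bullet> (P *v t) = t \<bullet> (P *v m)"
      using sym_pos_def_inner_commute[OF P, of m t] by (simp add: inner_commute)
    ultimately show ?thesis
      by (simp add: k_def matrix_vector_mult_diff_distrib inner_diff_left inner_diff_right)
  qed
  show ?thesis
  proof (rule that)
    show "CW * CQ ^ CARD('N) * exp (- k / 2) / CP > 0"
      using CW(1) CQ(1) CP(1) by simp
    fix t
    have "gaussian_density 0 (matrix_inv W) t * (\<Prod>l\<in>UNIV. gaussian_density (A l *v t) (matrix_inv Q) (d l))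
        = CW * CQ ^ CARD('N) * (exp (- (t \<bullet> (W *v t)) / 2) * exp (\<Sum>l\<in>UNIV. - ((d l - A l *v t) \<bullet> (Q *v (d l - A l *v t))) / 2))"
      by (simp add: CW(2) CQ(2) prod.distrib exp_sum)
    also have "exp (- (t \<bullet> (W *v t)) / 2) * exp (\<Sum>l\<in>UNIV. - ((d l - A l *v t) \<bullet> (Q *v (d l - A l *v t))) / 2)
        = exp (- (t \<bullet> (W *v t) + (\<Sum>l\<in>UNIV. (d l - A l *v t) \<bullet> (Q *v (d l - A l *v t)))) / 2)"
      by (simp add: sum_negf add_divide_distrib flip: exp_add sum_divide_distrib)
    also have "\<dots> = exp (- k / 2) * exp (- ((t - m) \<bullet> (P *v (t - m))) / 2)"
      unfolding quad by (simp add: add_divide_distrib flip: exp_add)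
    finally show "gaussian_density 0 (matrix_inv W) t * (\<Prod>l\<in>UNIV. gaussian_density (A l *v t) (matrix_inv Q) (d l))
        = CW * CQ ^ CARD('N) * exp (- k / 2) / CP * gaussian_density m (matrix_inv P) t"
      using CP(1) by (simp add: CP(2))
  qed
qed

text \<open>
  A density of a random variable integrates to one, so a single sample with this density supplies the
  normalisation.
\<close>

lemma distributed_gaussian_integral:
  fixes m :: "real^'p"
  assumes "prob_space M" and X: "distributed M lborel X (gaussian_density m C)" and "det C \<ge> 0"
  shows "(LINT t|lborel. gaussian_density m C t) = 1"
proof -
  interpret prob_space M by fact
  have [measurable]: "(\<lambda>x. ennreal (gaussian_density m C x)) \<in> borel_measurable borel"
    using distributed_borel_measurable[OF X] by simp
  have nn: "gaussian_density m C x \<ge> 0" for x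
    using \<open>det C \<ge> 0\<close> by (simp add: gaussian_density_def)
  \<comment> \<open>\<open>distributed\<close> gives measurability of the density as an \<open>ennreal\<close>-valued function only.\<close>
  have "(\<lambda>x. enn2real (ennreal (gaussian_density m C x))) \<in> borel_measurable borel"
    by measurable
  then have [measurable]: "gaussian_density m C \<in> borel_measurable borel"
    by (simp add: nn)
  have "(\<integral>\<^sup>+x. ennreal (gaussian_density m C x) \<partial>lborel) = 1"
    using distributed_nn_integral[OF X, of "\<lambda>_. 1"] by (simp add: emeasure_space_1)
  then show ?thesis
    by (subst integral_eq_nn_integral) (simp_all add: nn)
qed

text \<open>
  A \<open>K\<close>-orthonormal family \<open>w\<close> of coefficient vectors whose affine functions vanish at all inputs.
  Together with the \<open>direction i\<close> these form a \<open>K\<close>-orthogonal basis of \<open>real \<times> real^'n\<close>: by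
  \<open>card_basis\<close> their number is \<open>CARD('n) + 1\<close>.
\<close>

locale linear_discrepancy_basis = linear_discrepancy_eigen Mu Wu Mz Wz \<alpha> zt z g \<mu>
  for Mu Wu :: "real^'m^'m" and Mz Wz :: "real^'n^'n" and \<alpha> :: real and zt :: "real^'n"
    and z :: "'N::finite \<Rightarrow> real^'n" and g :: "'N \<Rightarrow> real^'N" and \<mu> :: "'N \<Rightarrow> real" +
  fixes w :: "'k::finite \<Rightarrow> real \<times> (real^'n)"
  assumes K_orthonormal: "\<And>k k'. K (w k) \<bullet> w k' = (if k = k' then 1 else 0)"
    and unobserved: "\<And>l k. observation l \<bullet> w k = 0"
    and card_basis: "CARD('N) + CARD('k) = CARD('n) + 1"
begin

lemma card_parameters: "CARD('m + 'm \<times> 'n) = CARD('N + 'k) * CARD('m)"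
proof -
  have "CARD('m + 'm \<times> 'n) = (CARD('n) + 1) * CARD('m)"
    by (simp add: card_sum)
  then show ?thesis
    by (simp only: card_basis[symmetric] card_sum)
qed

lemma direction_K_direction: "direction i \<bullet> K (direction j) = (if i = j then \<mu> i else 0)"
  by (simp add: K_direction_inner flip: K_inner_commute)

lemma complement_K_complement: "w k \<bullet> K (w k') = (if k = k' then 1 else 0)"
  by (simp add: K_orthonormal flip: K_inner_commute)

lemma complement_K_direction: "w k \<bullet> K (direction i) = 0"
  by (simp add: K_direction inner_sum_right inner_commute[of "w k"] unobserved)

lemma direction_K_complement: "direction i \<bullet> K (w k) = 0"
  using complement_K_direction[of k i] by (simp add: inner_commute flip: K_inner_commute)

lemmas K_orthogonal =
  direction_K_direction complement_K_complement complement_K_direction direction_K_complement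

text \<open>
  Data carry no information along the unobserved directions, where the posterior equals the prior.
\<close>

lemma posterior_precision_complement: "posterior_precision *v tensor u (w k) = tensor (Wu *v u) (K (w k))"
  by (simp add: posterior_precision_tensor unobserved linear_0[OF linear_tensor_right])

text \<open>
  The basis is \<open>K\<close>-orthonormal after scaling \<open>direction i\<close> by \<open>1 / \<surd>\<mu>\<^sub>i\<close>, so \<open>W\<^sub>u \<otimes> K\<close> consists of
  copies of the block \<open>W\<^sub>u\<close>.
\<close>

lemma sym_pos_def_prior_precision: "sym_pos_def (prior_precision Wu Wz Mz zt)"
proof (rule sym_pos_def_of_blocks[where T="\<lambda>j u. tensor u (case j of Inl i \<Rightarrow> (1 / sqrt (\<mu> i)) *\<^sub>R direction i | Inr k \<Rightarrow> w k)"
      and Q="\<lambda>_ :: 'N + 'k. Wu"])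
  let ?x = "\<lambda>j. case j of Inl i \<Rightarrow> (1 / sqrt (\<mu> i)) *\<^sub>R direction i | Inr k \<Rightarrow> w k"
  have "?x i \<bullet> K (?x j) = (if i = j then 1 else 0)" for i j
    using eigenvalue_pos[THEN less_imp_neq, symmetric] eigenvalue_pos[THEN less_imp_le]
    by (cases i; cases j) (simp_all add: linear_cmul[OF coefficient_precision_linear] K_orthogonal)
  then show "tensor u (?x i) \<bullet> (prior_precision Wu Wz Mz zt *v tensor v (?x j)) = (if i = j then u \<bullet> (Wu *v v) else 0)"
    for i j u v
    by (simp add: prior_precision_tensor[OF Mz_symmetric] inner_tensor)
qed (use card_parameters Wu linear_tensor_left in simp_all)

text \<open>
  The posterior sample splits into blocks \<open>u \<otimes> x\<close>, one for each basis vector \<open>x\<close>. The scaling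
  \<open>\<surd>(\<alpha> / \<mu>\<^sub>i)\<close> makes the pulled-back precision of an eigendirection equal to \<open>\<alpha> W\<^sub>u + \<mu>\<^sub>i M\<^sub>u\<close>.
\<close>

definition sample_map :: "'N + 'k \<Rightarrow> real^'m \<Rightarrow> real^('m + 'm \<times> 'n)" where
  "sample_map j u = (case j of Inl i \<Rightarrow> sqrt (\<alpha> / \<mu> i) *\<^sub>R tensor u (direction i) | Inr k \<Rightarrow> tensor u (w k))"

definition sample_precision :: "'N + 'k \<Rightarrow> real^'m^'m" where
  "sample_precision j = (case j of Inl i \<Rightarrow> \<alpha> *\<^sub>R Wu + \<mu> i *\<^sub>R Mu | Inr k \<Rightarrow> Wu)"

lemma linear_sample_map: "linear (sample_map j)"
  by (rule linearI)
     (auto simp: sample_map_def tensor_add_left tensor_scaleR_left scaleR_add_right split: sum.split)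

lemma sym_pos_def_sample_precision: "sym_pos_def (sample_precision j)"
  using eigenvalue_pos \<alpha> Mu Wu
  by (auto simp: sample_precision_def intro!: sym_pos_def_add sym_pos_def_scaleR split: sum.split)

lemma sample_map_orthogonal:
  "sample_map i v \<bullet> (posterior_precision *v sample_map j v') = (if i = j then v \<bullet> (sample_precision i *v v') else 0)"
proof -
  have "sqrt (\<alpha> / \<mu> i) * (sqrt (\<alpha> / \<mu> i) * (x * \<mu> i / \<alpha>)) = x" for i x
  proof -
    have "sqrt (\<alpha> / \<mu> i) * sqrt (\<alpha> / \<mu> i) = \<alpha> / \<mu> i"
      using eigenvalue_pos[of i] \<alpha> by simp
    then show ?thesis
      using eigenvalue_pos[of i] \<alpha> by (simp add: field_simps)
  qed
  then show ?thesis
    by (cases i; cases j) (simp_all add: sample_map_def sample_precision_def posterior_precision_direction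
      posterior_precision_complement matrix_vector_mult_scaleR inner_tensor K_orthogonal)
qed

lemmas sample_map_blocks =
  card_parameters linear_sample_map sym_pos_def_sample_precision sample_map_orthogonal

lemma sym_pos_def_posterior_precision: "sym_pos_def posterior_precision"
  by (rule sym_pos_def_of_blocks[OF sample_map_blocks])

lemma distributed_posterior_sample:
  fixes X :: "'N + 'k \<Rightarrow> 'w \<Rightarrow> real^'m"
  assumes M: "prob_space M" and ind: "prob_space.indep_vars M (\<lambda>_. borel) X UNIV"
    and X: "\<And>j. distributed M lborel (X j) (gaussian_density 0 (matrix_inv (sample_precision j)))"
  shows "distributed M lborel
     (\<lambda>\<omega>. c + (\<Sum>i\<in>UNIV. sqrt (\<alpha> / \<mu> i) *\<^sub>R tensor (X (Inl i) \<omega>) (direction i)) + (\<Sum>k\<in>UNIV. tensor (X (Inr k) \<omega>) (w k)))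
     (gaussian_density c (matrix_inv posterior_precision))"
  using distributed_gaussian_sum[OF sample_map_blocks M ind X, of c]
  by (simp add: sample_map_def sum_plus_UNIV add.assoc)

lemma posterior_cov_eq: "posterior_cov Wu Wz Mu Mz zt \<alpha> z = matrix_inv posterior_precision"
  by (simp add: posterior_cov_def posterior_precision_def Let_def)

lemma posterior_precision_posterior_mean:
  "posterior_precision *v posterior_mean Wu Wz Mu Mz zt \<alpha> z d
    = (1 / \<alpha>) *\<^sub>R (\<Sum>l\<in>UNIV. tensor (Mu *v d l) (observation l))"
proof -
  have "posterior_mean Wu Wz Mu Mz zt \<alpha> z d
      = (1 / \<alpha>) *\<^sub>R (matrix_inv posterior_precision *v
          ((transpose (stack_rows (\<lambda>l. discrepancy_matrix Mz (z l))) ** kron (mat 1) Mu) *v stack_vec d))"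
    by (simp add: posterior_mean_def Let_def posterior_cov_eq flip: matrix_vector_mul_assoc)
  then show ?thesis
    unfolding transpose_stack_rows_kron_stack_vec transpose_discrepancy[OF Mz_symmetric] observation_def
    by (simp add: matrix_vector_mult_scaleR matrix_inv_vector_right
        sym_pos_def_invertible[OF sym_pos_def_posterior_precision])
qed

lemma posterior_mean_expansion:
  fixes d u :: "'N \<Rightarrow> real^'m" and ui :: "'N \<Rightarrow> 'N \<Rightarrow> real^'m"
  assumes u: "\<And>l. Wu *v u l = Mu *v d l"
    and ui: "\<And>i l. (\<alpha> *\<^sub>R Wu + \<mu> i *\<^sub>R Mu) *v ui i l = Mu *v u l"
  shows "posterior_mean Wu Wz Mu Mz zt \<alpha> z d
    = (1 / \<alpha>) *\<^sub>R (\<Sum>l\<in>UNIV. tensor (u l) (lift l)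
           - (\<Sum>i\<in>UNIV. (\<mu> i * g i $ l) *\<^sub>R tensor (ui i l) (direction i)))" (is "?m = (1 / \<alpha>) *\<^sub>R ?r")
proof -
  have "posterior_precision *v ?m = posterior_precision *v ((1 / \<alpha>) *\<^sub>R ?r)"
    by (simp only: posterior_precision_posterior_mean matrix_vector_mult_scaleR posterior_precision_mean[OF u ui])
  from arg_cong[OF this, of "(*v) (matrix_inv posterior_precision)"] show ?thesis
    by (simp only: matrix_inv_vector_left[OF sym_pos_def_invertible[OF sym_pos_def_posterior_precision]])
qed

text \<open>
  By Bayes' formula, prior times likelihood is a multiple of the Gaussian density; the normalising
  integral is that multiple.
\<close>

lemma posterior_density_eq_gaussian:
  fixes d :: "'N \<Rightarrow> real^'m"
  assumes M: "prob_space M"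
    and X: "distributed M lborel X (gaussian_density (posterior_mean Wu Wz Mu Mz zt \<alpha> z d) (matrix_inv posterior_precision))"
  shows "posterior_density Wu Wz Mu Mz zt \<alpha> z d
    = gaussian_density (posterior_mean Wu Wz Mu Mz zt \<alpha> z d) (matrix_inv posterior_precision)"
proof -
  let ?m = "posterior_mean Wu Wz Mu Mz zt \<alpha> z d"
  have Q: "sym_pos_def ((1 / \<alpha>) *\<^sub>R Mu)"
    using Mu \<alpha> by (simp add: sym_pos_def_scaleR)
  have Q_inv: "matrix_inv ((1 / \<alpha>) *\<^sub>R Mu) = \<alpha> *\<^sub>R matrix_inv Mu"
    using \<alpha> by (simp add: matrix_inv_scaleR sym_pos_def_invertible[OF Mu])
  have m: "posterior_precision *v ?m
      = (\<Sum>l\<in>UNIV. transpose (discrepancy_matrix Mz (z l)) *v (((1 / \<alpha>) *\<^sub>R Mu) *v d l))"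
    unfolding posterior_precision_posterior_mean transpose_discrepancy[OF Mz_symmetric]
    by (simp add: observation_def tensor_scaleR_left scaleR_sum_right flip: scaleR_matrix_vector_assoc)
  obtain C where C: "C > 0"
    "\<And>t. gaussian_density 0 (matrix_inv (prior_precision Wu Wz Mz zt)) t
         * (\<Prod>l\<in>UNIV. gaussian_density (discrepancy_matrix Mz (z l) *v t) (matrix_inv ((1 / \<alpha>) *\<^sub>R Mu)) (d l))
        = C * gaussian_density ?m (matrix_inv posterior_precision) t"
    using gaussian_prior_times_likelihood[OF sym_pos_def_prior_precision Q sym_pos_def_posterior_precision
        posterior_precision_mult_vec m] by blast
  have "det (matrix_inv posterior_precision) \<ge> 0"
    by (rule less_imp_le) (rule sym_pos_def_det_pos[OF sym_pos_def_matrix_inv[OF sym_pos_def_posterior_precision]])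
  note int = distributed_gaussian_integral[OF M X this]
  show ?thesis
    using C(1) int
    by (simp add: fun_eq_iff posterior_density_def likelihood_def Let_def C(2)[unfolded Q_inv])
qed

end

section \<open>Representation of the posterior\<close>

theorem theorem4p2:
  fixes Mu Wu :: "real^'m^'m" and Mz Wz Wz_inv_sqrt :: "real^'n^'n"
    and \<alpha>d :: real and zt :: "real^'n"
    and z :: "'N::finite \<Rightarrow> real^'n" and d :: "'N \<Rightarrow> real^'m" and l1 :: 'N
    and e :: "real^'N" and Z :: "real^'N^'n" and G :: "real^'N^'N"
    and g :: "'N \<Rightarrow> real^'N" and \<mu> :: "'N \<Rightarrow> real"
    and y :: "'N \<Rightarrow> real^'n" and s :: "'N \<Rightarrow> real"
    and a :: "'N \<Rightarrow> real" and b :: "'N \<Rightarrow> 'N \<Rightarrow> real"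
    and u :: "'N \<Rightarrow> real^'m" and ui :: "'N \<Rightarrow> 'N \<Rightarrow> real^'m"
    and z_breve y_breve :: "'k::finite \<Rightarrow> real^'n" and s_breve :: "'k \<Rightarrow> real"
    and \<Omega> :: "'w measure"
    and u_hat :: "'N \<Rightarrow> 'w \<Rightarrow> real^'m" and u_breve :: "'k \<Rightarrow> 'w \<Rightarrow> real^'m"
    and \<theta>_hat \<theta>_breve :: "'w \<Rightarrow> real^('m + 'm \<times> 'n)"
  assumes "sym_pos_def Mu" "sym_pos_def Mz" "sym_pos_def Wu" "sym_pos_def Wz" "\<alpha>d > 0"
    and "sym_pos_def Wz_inv_sqrt" "Wz_inv_sqrt ** Wz_inv_sqrt = matrix_inv Wz"
    and "inj z" "independent (range z)"
    and "z l1 = zt"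
    and "e = (\<chi> i. 1)"
    and "Z = matrix_of_columns z"
    and "G = outer e e + transpose (Z - outer zt e) ** matrix_inv Wz ** (Z - outer zt e)"
    and "\<forall>i. G *v g i = \<mu> i *\<^sub>R g i"
    and "\<forall>i j. g i \<bullet> g j = (if i = j then 1 else 0)"
    and "\<forall>i. y i = Z *v g i - (e \<bullet> g i) *\<^sub>R zt"
    and "\<forall>i. s i = e \<bullet> g i - y i \<bullet> (matrix_inv Wz *v zt)"
    and "\<forall>l. a l = 1 - zt \<bullet> (matrix_inv Wz *v (z l - zt))"
    and "\<forall>i l. b i l = (z l - zt) \<bullet> (matrix_inv Wz *v (Z *v g i)) + (e \<bullet> g i) * a l"
    and "\<forall>l. u l = matrix_inv Wu *v (Mu *v d l)"
    and "\<forall>i l. ui i l = matrix_inv (\<alpha>d *\<^sub>R Wu + \<mu> i *\<^sub>R Mu) *v (Mu *v u l)"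
    and "CARD('k) = CARD('n) - CARD('N) + 1"
    and "\<forall>k k'. z_breve k \<bullet> z_breve k' = (if k = k' then 1 else 0)"
    and "\<forall>k l. l \<noteq> l1 \<longrightarrow> z_breve k \<bullet> (Wz_inv_sqrt *v (z l - zt)) = 0"
    and "\<forall>k. s_breve k = - (zt \<bullet> (Wz_inv_sqrt *v z_breve k))"
    and "\<forall>k. y_breve k = matrix_inv Mz *v (Wz_inv_sqrt *v z_breve k)"
    and "prob_space \<Omega>"
    and "\<forall>i. distributed \<Omega> lborel (u_hat i)
               (gaussian_density 0 (matrix_inv (\<alpha>d *\<^sub>R Wu + \<mu> i *\<^sub>R Mu)))"
    and "\<forall>k. distributed \<Omega> lborel (u_breve k) (gaussian_density 0 (matrix_inv Wu))"
    and "prob_space.indep_vars \<Omega> (\<lambda>_. borel) (case_sum u_hat u_breve) UNIV"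
    and "\<forall>\<omega>. \<theta>_hat \<omega> = sqrt \<alpha>d *\<^sub>R (\<Sum>i\<in>UNIV. (1 / sqrt (\<mu> i)) *\<^sub>R
               block_vec (s i *\<^sub>R u_hat i \<omega>)
                 (kron_vec (u_hat i \<omega>) (matrix_inv Mz *v (matrix_inv Wz *v y i))))"
    and "\<forall>\<omega>. \<theta>_breve \<omega> = (\<Sum>k\<in>UNIV.
               block_vec (s_breve k *\<^sub>R u_breve k \<omega>) (kron_vec (u_breve k \<omega>) (y_breve k)))"
  shows "posterior_mean Wu Wz Mu Mz zt \<alpha>d z d =
           (1 / \<alpha>d) *\<^sub>R (\<Sum>l\<in>UNIV.
             block_vec (a l *\<^sub>R u l)
               (kron_vec (u l) (matrix_inv Mz *v (matrix_inv Wz *v (z l - zt))))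
             - (\<Sum>i\<in>UNIV. b i l *\<^sub>R
                  block_vec (s i *\<^sub>R ui i l)
                    (kron_vec (ui i l) (matrix_inv Mz *v (matrix_inv Wz *v y i)))))
       \<and> distributed \<Omega> lborel
           (\<lambda>\<omega>. posterior_mean Wu Wz Mu Mz zt \<alpha>d z d + \<theta>_hat \<omega> + \<theta>_breve \<omega>)
           (gaussian_density (posterior_mean Wu Wz Mu Mz zt \<alpha>d z d)
             (posterior_cov Wu Wz Mu Mz zt \<alpha>d z))
       \<and> distributed \<Omega> lborel
           (\<lambda>\<omega>. posterior_mean Wu Wz Mu Mz zt \<alpha>d z d + \<theta>_hat \<omega> + \<theta>_breve \<omega>)
           (posterior_density Wu Wz Mu Mz zt \<alpha>d z d)"
proof -
  note Mu = assms(1) and Mz = assms(2) and Wu = assms(3) and Wz = assms(4) and \<alpha>d = assms(5)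
    and sqrt_spd = assms(6) and sqrt_eq = assms(7) and inj_z = assms(8) and indep_z = assms(9) and z_l1 = assms(10)
    and e_def = assms(11) and Z_def = assms(12) and G_def = assms(13) and G_eigen = assms(14)
    and g_orthonormal = assms(15) and y_eq = assms(16) and s_eq = assms(17) and a_eq = assms(18)
    and b_eq = assms(19) and u_eq = assms(20) and ui_eq = assms(21) and card_k = assms(22)
    and z_breve_orthonormal = assms(23) and z_breve_orth = assms(24) and s_breve_eq = assms(25)
    and y_breve_eq = assms(26) and prob = assms(27) and u_hat = assms(28) and u_breve = assms(29)
    and indep = assms(30) and \<theta>_hat_eq = assms(31) and \<theta>_breve_eq = assms(32)
  interpret linear_discrepancy Mu Wu Mz Wz \<alpha>d zt z
    by unfold_locales (fact Mu Mz Wu Wz \<alpha>d inj_z indep_z)+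
  have gram: "G $ l $ j = observation l \<bullet> lift j" for l j
  proof -
    have "column i (Z - outer zt e) = z i - zt" for i
      by (simp add: column_def Z_def matrix_of_columns_def outer_def e_def vec_eq_iff)
    then show ?thesis
      unfolding G_def observation_inner_lift
      by (simp add: matrix_congruence_entry outer_def e_def)
  qed
  interpret linear_discrepancy_eigen Mu Wu Mz Wz \<alpha>d zt z g \<mu>
  proof
    fix i l
    have "(G *v g i) $ l = \<mu> i * g i $ l"
      using G_eigen by simp
    then show "(\<Sum>j\<in>UNIV. (observation l \<bullet> lift j) * g i $ j) = \<mu> i * g i $ l"
      by (simp add: matrix_vector_mult_def gram)
  qed (use g_orthonormal in simp)
  have e_g: "e \<bullet> g i = (\<Sum>j\<in>UNIV. g i $ j)" for i
    by (simp add: e_def inner_vec_def)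
  have Z_g: "Z *v g i = (\<Sum>j\<in>UNIV. g i $ j *\<^sub>R z j)" for i
    by (simp add: Z_def matrix_of_columns_def matrix_vector_mult_def vec_eq_iff mult.commute)
  have y_sum: "y i = (\<Sum>j\<in>UNIV. g i $ j *\<^sub>R (z j - zt))" for i
    by (simp add: y_eq Z_g e_g scaleR_diff_right sum_subtractf scaleR_sum_left)
  have Wz_inv_y: "matrix_inv Wz *v y i = (\<Sum>j\<in>UNIV. g i $ j *\<^sub>R (matrix_inv Wz *v (z j - zt)))" for i
    by (simp add: y_sum linear_sum[OF matrix_vector_mul_linear] matrix_vector_mult_scaleR)
  have direction: "direction i = (s i, matrix_inv Mz *v (matrix_inv Wz *v y i))" for i
  proof -
    have "y i \<bullet> (matrix_inv Wz *v zt) = zt \<bullet> (matrix_inv Wz *v y i)"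
      by (subst sym_pos_def_inner_commute[OF sym_pos_def_matrix_inv[OF Wz]]) (rule inner_commute)
    then have "s i = (\<Sum>j\<in>UNIV. g i $ j * (1 - zt \<bullet> (matrix_inv Wz *v (z j - zt))))"
      by (simp add: s_eq e_g Wz_inv_y inner_sum_right right_diff_distrib sum_subtractf)
    then show ?thesis
      by (simp add: direction_def lift_def prod_eq_iff fst_sum snd_sum Wz_inv_y
          linear_sum[OF matrix_vector_mul_linear] matrix_vector_mult_scaleR)
  qed
  have lift: "lift l = (a l, matrix_inv Mz *v (matrix_inv Wz *v (z l - zt)))" for l
    by (simp add: lift_def a_eq)
  \<comment> \<open>\<open>b\<close> evaluates the affine function with coefficients \<open>direction i\<close> at the input \<open>z l\<close>, which is the
    \<open>l\<close>-th component of \<open>G g\<^sub>i\<close>.\<close>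
  have b: "b i l = \<mu> i * g i $ l" for i l
  proof -
    have "matrix_inv Wz *v (Z *v g i) = matrix_inv Wz *v y i + (e \<bullet> g i) *\<^sub>R (matrix_inv Wz *v zt)"
      by (simp add: y_eq matrix_vector_mult_diff_distrib matrix_vector_mult_scaleR)
    moreover have "zt \<bullet> (matrix_inv Wz *v (z l - zt)) = (z l - zt) \<bullet> (matrix_inv Wz *v zt)"
      by (subst sym_pos_def_inner_commute[OF sym_pos_def_matrix_inv[OF Wz]]) (rule inner_commute)
    ultimately have "b i l = (z l - zt) \<bullet> (matrix_inv Wz *v y i) + e \<bullet> g i"
      by (simp add: b_eq a_eq inner_add_right algebra_simps)
    also have "\<dots> = observation l \<bullet> direction i"
      by (simp add: direction_def inner_sum_right observation_inner_lift Wz_inv_y e_g distrib_left sum.distrib)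
    finally show ?thesis by (simp add: observation_inner_direction)
  qed
  define w where "w k = (s_breve k, y_breve k)" for k
  have Mz_y_breve: "Mz *v y_breve k = Wz_inv_sqrt *v z_breve k" for k
    by (simp add: y_breve_eq matrix_inv_vector_right Mz_invertible)
  \<comment> \<open>\<open>s_breve\<close> is chosen such that the affine function with coefficients \<open>w k\<close> vanishes at \<open>zt\<close>.\<close>
  have w_coordinate: "fst (w k) + zt \<bullet> (Mz *v snd (w k)) = 0" for k
    by (simp add: w_def Mz_y_breve s_breve_eq)
  interpret linear_discrepancy_basis Mu Wu Mz Wz \<alpha>d zt z g \<mu> w
  proof
    fix k k'
    have "Wz_inv_sqrt ** (Wz ** Wz_inv_sqrt) = mat 1"
    proof -
      have "Wz ** Wz_inv_sqrt ** Wz_inv_sqrt = mat 1"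
        by (simp add: sqrt_eq matrix_inv_mult_right Wz_invertible flip: matrix_mul_assoc)
      then show ?thesis by (simp add: matrix_left_right_inverse)
    qed
    then have "Wz_inv_sqrt *v (Wz *v (Wz_inv_sqrt *v v)) = v" for v
      by (simp add: matrix_vector_mul_assoc matrix_mul_assoc)
    then have "(Wz *v (Wz_inv_sqrt *v z_breve k)) \<bullet> (Wz_inv_sqrt *v z_breve k') = z_breve k \<bullet> z_breve k'"
      by (simp add: sym_pos_def_inner_commute[OF sqrt_spd])
    then show "K (w k) \<bullet> w k' = (if k = k' then 1 else 0)"
      unfolding coefficient_precision_inner[OF Mz_symmetric] w_coordinate
      by (simp add: w_def Mz_y_breve z_breve_orthonormal)
  next
    fix l k
    \<comment> \<open>Only the increment from \<open>zt\<close> to \<open>z l\<close> counts; it is zero for \<open>l = l1\<close>, the index exempt from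
      the orthogonality assumption.\<close>
    have "observation l \<bullet> w k = (z l - zt) \<bullet> (Mz *v snd (w k)) + (fst (w k) + zt \<bullet> (Mz *v snd (w k)))"
      by (simp add: observation_def w_def inner_diff_left matrix_vector_mult_diff_distrib
          sym_pos_def_inner_commute[OF Mz])
    also have "\<dots> = z_breve k \<bullet> (Wz_inv_sqrt *v (z l - zt))"
    proof -
      have "(z l - zt) \<bullet> (Wz_inv_sqrt *v z_breve k) = z_breve k \<bullet> (Wz_inv_sqrt *v (z l - zt))"
        by (subst sym_pos_def_inner_commute[OF sqrt_spd]) (rule inner_commute)
      then show ?thesis
        unfolding w_coordinate by (simp add: w_def Mz_y_breve)
    qed
    also have "\<dots> = 0"
      using z_breve_orth z_l1 by (cases "l = l1") auto
    finally show "observation l \<bullet> w k = 0" .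
  next
    \<comment> \<open>Independent inputs are at most \<open>CARD('n)\<close> many, so the subtraction in the size of the index
      type \<open>'k\<close> does not truncate.\<close>
    have "CARD('N) = card (range z)"
      by (simp add: card_image inj_z)
    also have "\<dots> \<le> CARD('n)"
      using independent_bound[OF indep_z] by simp
    finally show "CARD('N) + CARD('k) = CARD('n) + 1"
      using card_k by simp
  qed
  have tensor: "block_vec (r *\<^sub>R v) (kron_vec v q) = tensor v (r, q)" for r v q
    by (simp add: tensor_def)
  let ?m = "posterior_mean Wu Wz Mu Mz zt \<alpha>d z d"
  have mean: "?m = (1 / \<alpha>d) *\<^sub>R (\<Sum>l\<in>UNIV. tensor (u l) (lift l)
      - (\<Sum>i\<in>UNIV. b i l *\<^sub>R tensor (ui i l) (direction i)))"
    unfolding b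
  proof (rule posterior_mean_expansion)
    show "Wu *v u l = Mu *v d l" for l
      by (simp add: u_eq matrix_inv_vector_right sym_pos_def_invertible[OF Wu])
    show "(\<alpha>d *\<^sub>R Wu + \<mu> i *\<^sub>R Mu) *v ui i l = Mu *v u l" for i l
      using sym_pos_def_invertible[OF sym_pos_def_sample_precision[of "Inl i"]]
      by (simp add: ui_eq matrix_inv_vector_right sample_precision_def)
  qed
  have "distributed \<Omega> lborel (case_sum u_hat u_breve j) (gaussian_density 0 (matrix_inv (sample_precision j)))" for j
    using u_hat u_breve by (simp add: sample_precision_def split: sum.split)
  note distributed_posterior_sample[OF prob indep this, of ?m]
  moreover have "?m + \<theta>_hat \<omega> + \<theta>_breve \<omega>
      = ?m + (\<Sum>i\<in>UNIV. sqrt (\<alpha>d / \<mu> i) *\<^sub>R tensor (case_sum u_hat u_breve (Inl i) \<omega>) (direction i))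
        + (\<Sum>k\<in>UNIV. tensor (case_sum u_hat u_breve (Inr k) \<omega>) (w k))" for \<omega>
    unfolding spec[OF \<theta>_hat_eq] spec[OF \<theta>_breve_eq] tensor direction w_def
    by (simp add: real_sqrt_divide scaleR_sum_right)
  ultimately have sample: "distributed \<Omega> lborel (\<lambda>\<omega>. ?m + \<theta>_hat \<omega> + \<theta>_breve \<omega>)
      (gaussian_density ?m (matrix_inv posterior_precision))"
    by (simp only:)
  show ?thesis
    unfolding tensor lift[symmetric] direction[symmetric]
    using mean sample posterior_density_eq_gaussian[OF prob sample]
    by (simp only: posterior_cov_eq simp_thms)
qed

end
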